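(* Let $G$ be a finitely generated group and let $\mathcal{X}$ be a $G$-space. If $G$ contains a strongly contracting element for $G\curvearrowright\mathcal{X}$, then so does every infinite normal subgroup of $G$.
   Context: A $G$-space is a proper, geodesic metric space $(\mathcal{X},d)$ with a properly discontinuous, isometric action of $G$. Fix a basepoint $o\in\mathcal{X}$. A coarse map $\pi\colon\mathcal{X}\to\mathcal{A}$, $\mathcal{A}\subset\mathcal{X}$, assigns to each point a (nonempty) subset of $\mathcal{A}$ of uniformly bounded diameter. It is strongly contracting if there is $C\geqslant 0$ such that: for $a\in\mathcal{A}$, $\pi(a)$ and $\{a\}$ are contained in the closed $C$-neighborhoods of each other; $d(x_0,x_1)<d(x_0,\mathcal{A})-C$ implies $\operatorname{diam}(\pi(x_0)\cup\pi(x_1))\leqslant C$ for all $x_0,x_1\in\mathcal{X}$; and $d(x,\pi(x))-d(x,\mathcal{A})\leqslant C$ for all $x\in\mathcal{X}$. An element $h\in G$ is strongly contracting for $G\curvearrowright\mathcal{X}$ if $i\mapsto h^i.o$ ($i\in\mathbb{Z}$) is a quasi-geodesic (a quasi-isometric embedding) and there exist a subset $\mathcal{A}\subset\mathcal{X}$ on which $\langle h\rangle$ acts cocompactly and a strongly contracting coarse map $\pi\colon\mathcal{X}\to\mathcal{A}$. *)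

theory Defs
  imports
    "HOL-Analysis.Analysis"
    "HOL-Algebra.Group_Action"
    "HOL-Algebra.Generated_Groups"
begin

definition finitely_generated_group :: "('g, 'm) monoid_scheme \<Rightarrow> bool" where
  "finitely_generated_group G \<longleftrightarrow>
     group G \<and> (\<exists>S. finite S \<and> S \<subseteq> carrier G \<and> generate G S = carrier G)"

text \<open>
  A \<open>G\<close>-space. The underlying space is the whole type \<open>'x\<close>. Proper discontinuity is the
  usual condition that a compact set meets only finitely many of its translates; for isometric
  actions on proper spaces this agrees with the versions phrased with balls.
\<close>

locale G_space = group_action G UNIV \<phi>
  for G :: "('g, 'm) monoid_scheme" and \<phi> :: "'g \<Rightarrow> 'x::metric_space \<Rightarrow> 'x" +
  assumes proper: "\<And>(x::'x) r. compact (cball x r)"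
    and geodesic: "\<And>x y::'x. \<exists>\<gamma> :: real \<Rightarrow> 'x. \<gamma> 0 = x \<and> \<gamma> (dist x y) = y \<and>
          (\<forall>s\<in>{0..dist x y}. \<forall>t\<in>{0..dist x y}. dist (\<gamma> s) (\<gamma> t) = \<bar>s - t\<bar>)"
    and isometric: "\<And>g x y. g \<in> carrier G \<Longrightarrow> dist (\<phi> g x) (\<phi> g y) = dist x y"
    and properly_discontinuous:
      "\<And>K. compact K \<Longrightarrow> finite {g \<in> carrier G. \<phi> g ` K \<inter> K \<noteq> {}}"

text \<open>A quasi-isometric embedding of the integers; \<^typ>\<open>int\<close> carries no metric in the library.\<close>

definition quasi_geodesic :: "(int \<Rightarrow> 'x::metric_space) \<Rightarrow> bool" where
  "quasi_geodesic q \<longleftrightarrow>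
     (\<exists>L\<ge>1. \<exists>B\<ge>0. \<forall>i j.
        \<bar>real_of_int (i - j)\<bar> / L - B \<le> dist (q i) (q j) \<and>
        dist (q i) (q j) \<le> L * \<bar>real_of_int (i - j)\<bar> + B)"

text \<open>
  The equation below includes the invariance of \<open>A\<close> under the subgroup \<open>H\<close>. For a properly
  discontinuous isometric action on a proper space it is equivalent to \<open>A\<close> being invariant with
  compact quotient by \<open>H\<close>.
\<close>

definition acts_cocompactly_on ::
    "('g \<Rightarrow> 'x \<Rightarrow> 'x) \<Rightarrow> 'g set \<Rightarrow> 'x::topological_space set \<Rightarrow> bool" where
  "acts_cocompactly_on \<phi> H A \<longleftrightarrow> (\<exists>K. compact K \<and> K \<subseteq> A \<and> (\<Union>g\<in>H. \<phi> g ` K) = A)"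

text \<open>
  Boundedness is required separately because \<^const>\<open>diameter\<close> is a supremum in the reals, which
  carries no information for an unbounded set.
\<close>

definition coarse_map :: "'x::metric_space set \<Rightarrow> ('x \<Rightarrow> 'x set) \<Rightarrow> bool" where
  "coarse_map A \<pi> \<longleftrightarrow> (\<forall>x. \<pi> x \<noteq> {} \<and> \<pi> x \<subseteq> A) \<and>
     (\<exists>D. \<forall>x. bounded (\<pi> x) \<and> diameter (\<pi> x) \<le> D)"

definition closed_neighborhood :: "real \<Rightarrow> 'x::metric_space set \<Rightarrow> 'x set" where
  "closed_neighborhood C S = {x. infdist x S \<le> C}"

definition strongly_contracting_map :: "'x::metric_space set \<Rightarrow> ('x \<Rightarrow> 'x set) \<Rightarrow> bool" where
  "strongly_contracting_map A \<pi> \<longleftrightarrow> coarse_map A \<pi> \<and>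
     (\<exists>C\<ge>0.
        (\<forall>a\<in>A. \<pi> a \<subseteq> closed_neighborhood C {a} \<and> {a} \<subseteq> closed_neighborhood C (\<pi> a)) \<and>
        (\<forall>x0 x1. dist x0 x1 < infdist x0 A - C \<longrightarrow> diameter (\<pi> x0 \<union> \<pi> x1) \<le> C) \<and>
        (\<forall>x. infdist x (\<pi> x) - infdist x A \<le> C))"

text \<open>Here \<open>p\<close> is the basepoint.\<close>

definition strongly_contracting_element ::
    "('g, 'm) monoid_scheme \<Rightarrow> ('g \<Rightarrow> 'x \<Rightarrow> 'x::metric_space) \<Rightarrow> 'x \<Rightarrow> 'g \<Rightarrow> bool" where
  "strongly_contracting_element G \<phi> p h \<longleftrightarrow> h \<in> carrier G \<and>
     quasi_geodesic (\<lambda>i::int. \<phi> (h [^]\<^bsub>G\<^esub> i) p) \<and>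
     (\<exists>A \<pi>. acts_cocompactly_on \<phi> (generate G {h}) A \<and> strongly_contracting_map A \<pi>)"

end

theory Submission
  imports Defs
begin

text \<open>
  Let \<open>h\<close> be strongly contracting with axis \<open>A\<close>. Strong contraction is used only through its
  consequence that a geodesic joining two points with distant projections to \<open>A\<close> passes near both
  projections; this property is preserved by translating \<open>A\<close>, and it implies Behrstock's inequality
  for two translates with bounded mutual projections.

  If some \<open>n\<close> in the normal subgroup \<open>N\<close> satisfies no relation \<open>n h\<^sup>i = h\<^sup>j n\<close> with \<open>i\<close> and \<open>j\<close> nonzero,
  then \<open>A\<close> and \<open>n A\<close> have bounded mutual projections, and the commutator
  \<open>n h\<^sup>m n\<^sup>-\<^sup>1 h\<^sup>-\<^sup>m\<close>, which lies in \<open>N\<close>, acts by ping-pong on the half-spaces cut out by the alternating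
  translates of the two axes, so it is strongly contracting for large \<open>m\<close>. Otherwise \<open>N\<close> contains a
  nontrivial power of \<open>h\<close>: either directly from a relation with \<open>i \<noteq> j\<close>, or because
  each element of \<open>N\<close> commutes with a power of \<open>h\<close>, hence moves the basepoint to within a uniform
  distance of \<open>A\<close>, and \<open>N\<close> is infinite.
\<close>

section \<open>Contraction and bottlenecks\<close>

text \<open>The slack 1 makes such points exist for every nonempty \<open>A\<close>, closed or
  not.\<close>

definition near_proj :: "'a::metric_space set \<Rightarrow> 'a \<Rightarrow> 'a \<Rightarrow> bool" where
  "near_proj A x a \<longleftrightarrow> a \<in> A \<and> (\<forall>b\<in>A. dist x a \<le> dist x b + 1)"

text \<open>Only distances occur, so isometries preserve the property and no geodesic or projection
  has to be chosen.\<close>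

definition bottleneck :: "'a::metric_space set \<Rightarrow> real \<Rightarrow> bool" where
  "bottleneck A C \<longleftrightarrow> (\<forall>x y a b. near_proj A x a \<longrightarrow> near_proj A y b \<longrightarrow>
     dist a b \<le> C \<or> dist x a + dist a b + dist b y \<le> dist x y + C)"

definition geodesic_on :: "real set \<Rightarrow> (real \<Rightarrow> 'a::metric_space) \<Rightarrow> bool" where
  "geodesic_on I \<gamma> \<longleftrightarrow> (\<forall>s\<in>I. \<forall>t\<in>I. dist (\<gamma> s) (\<gamma> t) = \<bar>s - t\<bar>)"

lemma near_projD:
  assumes "near_proj A x a"
  shows "a \<in> A" "b \<in> A \<Longrightarrow> dist x a \<le> dist x b + 1"
  using assms by (auto simp: near_proj_def)

lemma infdist_less_obtains:
  assumes "A \<noteq> {}" "infdist x A < r"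
  obtains a where "a \<in> A" "dist x a < r"
  using assms cInf_lessD[of "dist x ` A" r] by (auto simp: infdist_notempty)

lemma near_proj_exists:
  assumes "A \<noteq> {}"
  shows "\<exists>a. near_proj A x a"
proof -
  obtain a where a: "a \<in> A" "dist x a < infdist x A + 1"
    using infdist_less_obtains[OF assms, of x "infdist x A + 1"] by auto
  have "dist x a \<le> dist x b + 1" if "b \<in> A" for b
    using a infdist_le[OF that, of x] by linarith
  then show ?thesis
    using a by (auto simp: near_proj_def)
qed

lemma bottleneckD:
  assumes "bottleneck A C" "near_proj A x a" "near_proj A y b" "dist a b > C"
  shows "dist x a + dist a b + dist b y \<le> dist x y + C"
  using assms unfolding bottleneck_def by fastforce

text \<open>With \<open>y = x\<close> the second alternative of the bottleneck also forces
  \<open>dist a b \<le> C\<close>.\<close>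

lemma bottleneck_near_unique:
  assumes "bottleneck A C" "near_proj A x a" "near_proj A x b"
  shows "dist a b \<le> C"
proof (rule ccontr)
  assume "\<not> dist a b \<le> C"
  then have "dist x a + dist a b + dist b x \<le> dist x x + C"
    using assms by (intro bottleneckD) auto
  then show False
    using \<open>\<not> dist a b \<le> C\<close> zero_le_dist[of x a] zero_le_dist[of b x] by simp
qed

text \<open>A point-valued selection from a set-valued coarse map, with all bounds merged into one
  constant.\<close>

locale contracting_retraction =
  fixes A :: "'a::metric_space set" and \<rho> :: "'a \<Rightarrow> 'a" and C :: real
  assumes C_nonneg: "0 \<le> C"
    and retract_in: "\<rho> x \<in> A"
    and retract_close: "dist x (\<rho> x) \<le> infdist x A + C"
    and contraction: "dist x y < infdist x A - C \<Longrightarrow> dist (\<rho> x) (\<rho> y) \<le> C"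
begin

text \<open>
  Away from \<^term>\<open>A\<close> a step of length \<open>2 * C + 1\<close> moves the projection by at most \<open>C\<close>, so the
  projection travels at no more than half the speed of the geodesic.
\<close>

lemma drift:
  assumes "geodesic_on {s..t} \<gamma>" "s \<le> t"
    and "\<And>u. s \<le> u \<Longrightarrow> u < t \<Longrightarrow> 3 * C + 2 \<le> infdist (\<gamma> u) A"
  shows "dist (\<rho> (\<gamma> s)) (\<rho> (\<gamma> t)) \<le> (t - s) / 2 + C"
proof -
  obtain n :: nat where "t - s \<le> real n"
    using real_arch_simple by blast
  then show ?thesis
    using assms
  proof (induction n arbitrary: s)
    case 0
    then show ?case using C_nonneg by simp
  next
    case (Suc n)
    show ?case
    \<comment> \<open>At distance at least \<open>3 * C + 2\<close> from \<open>A\<close>, every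
      step shorter than \<open>2 * C + 2\<close> falls under \<open>contraction\<close>.\<close>
    proof (cases "t - s < 2 * C + 2")
      case True
      have "dist (\<gamma> s) (\<gamma> t) = t - s"
        using Suc.prems by (simp add: geodesic_on_def)
      then have "dist (\<rho> (\<gamma> s)) (\<rho> (\<gamma> t)) \<le> C" if "s < t"
        using True Suc.prems(4)[of s] that by (intro contraction) auto
      then show ?thesis
        using Suc.prems(3) C_nonneg by (cases "s = t") (auto intro: order_trans)
    next
      case False
      define s' where "s' = s + (2 * C + 1)"
      have s': "s \<le> s'" "s' \<le> t" "s < t" "s' \<ge> s + 1"
        using False C_nonneg by (auto simp: s'_def)
      have "dist (\<gamma> s) (\<gamma> s') = 2 * C + 1"
        using Suc.prems(2) s' C_nonneg by (simp add: geodesic_on_def s'_def)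
      then have 1: "dist (\<rho> (\<gamma> s)) (\<rho> (\<gamma> s')) \<le> C"
        using Suc.prems(4)[of s] s' by (intro contraction) auto
      have 2: "dist (\<rho> (\<gamma> s')) (\<rho> (\<gamma> t)) \<le> (t - s') / 2 + C"
        using Suc.prems s' by (intro Suc.IH) (auto simp: geodesic_on_def)
      show ?thesis
        using 1 2 dist_triangle[of "\<rho> (\<gamma> s)" "\<rho> (\<gamma> t)" "\<rho> (\<gamma> s')"] C_nonneg
        by (simp add: s'_def field_simps)
    qed
  qed
qed

text \<open>\<open>contraction\<close> controls end stretches of lengths \<open>\<tau>\<close> and
  \<open>\<sigma>\<close>, \<open>drift\<close> the middle, so \<open>?d\<close> is at most
  \<open>3 * C\<close> plus half the middle length. The detour through the projections bounds the
  middle length by \<open>?d + 4 * C + 2\<close>; solving for \<open>?d\<close> gives the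
  constant.\<close>

lemma retract_diameter_away:
  assumes geod: "geodesic_on {s..t} \<gamma>" and "s \<le> t"
    and far: "\<And>u. s \<le> u \<Longrightarrow> u < t \<Longrightarrow> 3 * C + 2 \<le> infdist (\<gamma> u) A"
  shows "dist (\<rho> (\<gamma> s)) (\<rho> (\<gamma> t)) \<le> 10 * C + 2"
proof (cases "s = t")
  case True
  then show ?thesis using C_nonneg by simp
next
  case False
  then have "s < t" using assms by simp
  define e where "e = infdist (\<gamma> t) A"
  define \<tau> where "\<tau> = infdist (\<gamma> s) A - C - 1"
  \<comment> \<open>The endpoint at \<open>t\<close> may be close to \<open>A\<close>, since
    \<open>far\<close> stops short of it; the last stretch is then empty.\<close>
  define \<sigma> where "\<sigma> = max 0 (e - C - 1)"
  let ?d = "dist (\<rho> (\<gamma> s)) (\<rho> (\<gamma> t))"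
  have \<tau>: "\<tau> > 0"
    using far[of s] \<open>s < t\<close> C_nonneg by (simp add: \<tau>_def)
  have D: "dist (\<gamma> u) (\<gamma> v) = \<bar>u - v\<bar>" if "u \<in> {s..t}" "v \<in> {s..t}" for u v
    using geod that by (simp add: geodesic_on_def)
  show ?thesis
  proof (cases "t - s < \<tau> + 1")
    case True
    then have "?d \<le> C"
      using D[of s t] \<open>s < t\<close> by (intro contraction) (auto simp: \<tau>_def)
    then show ?thesis using C_nonneg by simp
  next
    case c1: False
    have d1: "dist (\<rho> (\<gamma> s)) (\<rho> (\<gamma> (s + \<tau>))) \<le> C"
      using D[of s "s + \<tau>"] \<tau> c1 by (intro contraction) (auto simp: \<tau>_def)
    show ?thesis
    \<comment> \<open>If this holds, the contraction ranges of both ends reach the point at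
      \<open>s + \<tau>\<close>.\<close>
    proof (cases "t - s - \<tau> < e - C")
      case True
      have "dist (\<rho> (\<gamma> t)) (\<rho> (\<gamma> (s + \<tau>))) \<le> C"
        using D[of t "s + \<tau>"] \<tau> c1 True by (intro contraction) (auto simp: e_def)
      then show ?thesis
        using d1 dist_triangle2[of "\<rho> (\<gamma> s)" "\<rho> (\<gamma> t)" "\<rho> (\<gamma> (s + \<tau>))"] C_nonneg by simp
    next
      case False
      have le: "s + \<tau> \<le> t - \<sigma>" "\<sigma> \<ge> 0"
        using False c1 by (auto simp: \<sigma>_def)
      have d2: "dist (\<rho> (\<gamma> t)) (\<rho> (\<gamma> (t - \<sigma>))) \<le> C"
      proof (cases "\<sigma> = 0")
        case True
        then show ?thesis using C_nonneg by simp
      next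
        case nz: False
        then show ?thesis
          using D[of t "t - \<sigma>"] \<tau> le by (intro contraction) (auto simp: \<sigma>_def e_def max_def split: if_splits)
      qed
      have d3: "dist (\<rho> (\<gamma> (s + \<tau>))) (\<rho> (\<gamma> (t - \<sigma>))) \<le> (t - \<sigma> - (s + \<tau>)) / 2 + C"
        using le \<tau> far geod by (intro drift) (auto simp: geodesic_on_def)
      have "t - s = dist (\<gamma> s) (\<gamma> t)"
        using D[of s t] \<open>s < t\<close> by simp
      also have "\<dots> \<le> dist (\<gamma> s) (\<rho> (\<gamma> s)) + ?d + dist (\<gamma> t) (\<rho> (\<gamma> t))"
        using dist_triangle[of "\<gamma> s" "\<gamma> t" "\<rho> (\<gamma> s)"] dist_triangle2[of "\<rho> (\<gamma> s)" "\<gamma> t" "\<rho> (\<gamma> t)"]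
        by simp
      also have "\<dots> \<le> (\<tau> + 2 * C + 1) + ?d + (\<sigma> + 2 * C + 1)"
        using retract_close[of "\<gamma> s"] retract_close[of "\<gamma> t"] by (simp add: \<tau>_def \<sigma>_def e_def)
      finally have len: "t - s \<le> \<tau> + \<sigma> + ?d + 4 * C + 2" by simp
      have "?d \<le> C + ((t - \<sigma> - (s + \<tau>)) / 2 + C) + C"
        using d1 d2 d3 dist_triangle[of "\<rho> (\<gamma> s)" "\<rho> (\<gamma> t)" "\<rho> (\<gamma> (s + \<tau>))"]
          dist_triangle2[of "\<rho> (\<gamma> (s + \<tau>))" "\<rho> (\<gamma> t)" "\<rho> (\<gamma> (t - \<sigma>))"] by simp
      then show ?thesis
        using len by (simp add: field_simps)
    qed
  qed
qed

text \<open>By \<open>retract_diameter_away\<close> the geodesic must come within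
  \<open>3 * C + 2\<close> of \<open>A\<close>. Up to the first such time the projection moves by at
  most \<open>10 * C + 2\<close>, so the geodesic passes within \<open>14 * C + 4\<close> of
  \<open>\<rho> x\<close>; the detour costs twice that.\<close>

lemma half_bottleneck:
  assumes geod: "\<gamma> 0 = x" "\<gamma> (dist x y) = y" "geodesic_on {0..dist x y} \<gamma>"
    and big: "dist (\<rho> x) (\<rho> y) > 10 * C + 2"
  shows "dist x (\<rho> x) + dist (\<rho> x) y \<le> dist x y + 28 * C + 8"
proof -
  define T where "T = {0..dist x y} \<inter> (\<lambda>t. infdist (\<gamma> t) A) -` {..3 * C + 2}"
  have D: "dist (\<gamma> u) (\<gamma> v) = \<bar>u - v\<bar>" if "u \<in> {0..dist x y}" "v \<in> {0..dist x y}" for u v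
    using geod that by (simp add: geodesic_on_def)
  have "continuous_on {0..dist x y} \<gamma>"
    unfolding continuous_on_iff using D by (metis dist_commute dist_real_def)
  then have "closed T"
    unfolding T_def
    by (intro continuous_closed_preimage continuous_on_infdist) auto
  then have "compact T"
    unfolding T_def by (metis Int_absorb2 T_def compact_Icc compact_Int_closed inf.cobounded1 inf_commute)
  have "T \<noteq> {}"
  proof
    assume "T = {}"
    then have "3 * C + 2 \<le> infdist (\<gamma> u) A" if "0 \<le> u" "u < dist x y" for u
      using that by (fastforce simp: T_def)
    then have "dist (\<rho> (\<gamma> 0)) (\<rho> (\<gamma> (dist x y))) \<le> 10 * C + 2"
      using geod by (intro retract_diameter_away) auto
    then show False using big geod by simp
  qed
  then obtain t where t: "t \<in> T" "\<And>u. u \<in> T \<Longrightarrow> t \<le> u"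
    using compact_attains_inf[OF \<open>compact T\<close>] by blast
  have t': "t \<in> {0..dist x y}" "infdist (\<gamma> t) A \<le> 3 * C + 2"
    using t by (auto simp: T_def)
  have "3 * C + 2 \<le> infdist (\<gamma> u) A" if "0 \<le> u" "u < t" for u
  proof (rule ccontr)
    assume "\<not> ?thesis"
    then have "u \<in> T" using that t' by (auto simp: T_def)
    then show False using t(2) that by fastforce
  qed
  then have "dist (\<rho> (\<gamma> 0)) (\<rho> (\<gamma> t)) \<le> 10 * C + 2"
    using t' geod by (intro retract_diameter_away) (auto simp: geodesic_on_def)
  moreover have "dist (\<gamma> t) (\<rho> (\<gamma> t)) \<le> 4 * C + 2"
    using retract_close[of "\<gamma> t"] t' by simp
  ultimately have 1: "dist (\<gamma> t) (\<rho> x) \<le> 14 * C + 4"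
    using dist_triangle2[of "\<gamma> t" "\<rho> x" "\<rho> (\<gamma> t)"] geod by simp
  have "dist x y = dist x (\<gamma> t) + dist (\<gamma> t) y"
    using D[of 0 t] D[of t "dist x y"] t' geod by auto
  then show ?thesis
    using 1 dist_triangle[of x "\<rho> x" "\<gamma> t"] dist_triangle3[of "\<rho> x" y "\<gamma> t"] by simp
qed

text \<open>The half bound is used twice, for \<open>x\<close>, \<open>y\<close> and from the other
  end for \<open>y\<close>, \<open>\<rho> x\<close>. The extra \<open>C\<close> in the threshold
  absorbs the distance from \<open>\<rho> x\<close> to \<open>\<rho> (\<rho> x)\<close>.\<close>

lemma retract_bottleneck:
  assumes geod: "\<And>x y::'a. \<exists>\<gamma>. \<gamma> 0 = x \<and> \<gamma> (dist x y) = y \<and> geodesic_on {0..dist x y} \<gamma>"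
    and big: "dist (\<rho> x) (\<rho> y) > 11 * C + 2"
  shows "dist x (\<rho> x) + dist (\<rho> x) (\<rho> y) + dist (\<rho> y) y \<le> dist x y + 56 * C + 16"
proof -
  have half: "dist x (\<rho> x) + dist (\<rho> x) y \<le> dist x y + 28 * C + 8"
    if "dist (\<rho> x) (\<rho> y) > 10 * C + 2" for x y
    using geod[of x y] half_bottleneck that by blast
  have "dist (\<rho> x) (\<rho> (\<rho> x)) \<le> C"
    using retract_close[of "\<rho> x"] retract_in[of x] by simp
  then have "dist (\<rho> y) (\<rho> (\<rho> x)) > 10 * C + 2"
    using big dist_triangle2[of "\<rho> x" "\<rho> y" "\<rho> (\<rho> x)"] by simp
  from half[OF this] half[of x y] show ?thesis
    using big C_nonneg by (simp add: dist_commute)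
qed

text \<open>Passes from \<open>\<rho>\<close> to arbitrary near projections. The constant is
  \<open>56 * C + 16\<close> plus four times the distance \<open>57 * C + 17\<close> between the two
  kinds of projection.\<close>

lemma bottleneck:
  assumes geod: "\<And>x y::'a. \<exists>\<gamma>. \<gamma> 0 = x \<and> \<gamma> (dist x y) = y \<and> geodesic_on {0..dist x y} \<gamma>"
  shows "bottleneck A (284 * C + 84)"
proof -
  let ?B = "56 * C + 16"
  \<comment> \<open>If \<open>\<rho> a\<close> were far from \<open>\<rho> x\<close>, going from
    \<open>x\<close> to \<open>a\<close> would cost the whole distance between them beyond
    \<open>dist x (\<rho> x)\<close>, up to \<open>?B\<close>; but \<open>a\<close> is nearly
    closest to \<open>x\<close>.\<close>
  have near: "dist a (\<rho> x) \<le> 57 * C + 17" if a: "near_proj A x a" for x a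
  proof -
    have aA: "a \<in> A" and ax: "dist x a \<le> dist x (\<rho> x) + 1"
      using near_projD[OF a] retract_in by auto
    have 1: "dist a (\<rho> a) \<le> C"
      using retract_close[of a] aA by simp
    have "dist (\<rho> x) (\<rho> a) \<le> ?B + 1"
    proof (cases "dist (\<rho> x) (\<rho> a) > 11 * C + 2")
      case True
      then show ?thesis
        using retract_bottleneck[OF geod True] ax zero_le_dist[of "\<rho> a" a] by linarith
    next
      case False
      then show ?thesis using C_nonneg by simp
    qed
    then show ?thesis
      using 1 dist_triangle2[of a "\<rho> x" "\<rho> a"] by simp
  qed
  show ?thesis
    unfolding bottleneck_def
  proof (intro allI impI)
    fix x y a b
    assume ab: "near_proj A x a" "near_proj A y b"
    have na: "dist a (\<rho> x) \<le> 57 * C + 17" and nb: "dist b (\<rho> y) \<le> 57 * C + 17"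
      using near ab by auto
    have 1: "dist a b \<le> dist a (\<rho> x) + dist (\<rho> x) (\<rho> y) + dist b (\<rho> y)"
      using dist_triangle[of a b "\<rho> x"] dist_triangle2[of "\<rho> x" b "\<rho> y"] by simp
    show "dist a b \<le> 284 * C + 84 \<or>
        dist x a + dist a b + dist b y \<le> dist x y + (284 * C + 84)"
    proof (cases "dist (\<rho> x) (\<rho> y) > 11 * C + 2")
      case True
      have "dist x a \<le> dist x (\<rho> x) + dist a (\<rho> x)" "dist b y \<le> dist (\<rho> y) y + dist b (\<rho> y)"
        by (metis dist_triangle2) (metis dist_triangle add.commute)
      then show ?thesis
        using retract_bottleneck[OF geod True] na nb 1 by simp
    next
      case False
      then show ?thesis using na nb 1 C_nonneg by simp
    qed
  qed
qed

end

lemma strongly_contracting_bottleneck: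
  fixes A :: "'a::metric_space set"
  assumes geod: "\<And>x y::'a. \<exists>\<gamma>. \<gamma> 0 = x \<and> \<gamma> (dist x y) = y \<and> geodesic_on {0..dist x y} \<gamma>"
    and "strongly_contracting_map A \<pi>"
  shows "\<exists>C\<ge>0. bottleneck A C"
proof -
  have cm: "coarse_map A \<pi>"
    using assms by (simp add: strongly_contracting_map_def)
  obtain D where D: "\<And>x. bounded (\<pi> x)" "\<And>x. diameter (\<pi> x) \<le> D"
    using cm by (auto simp: coarse_map_def)
  have ne: "\<pi> x \<noteq> {}" "\<pi> x \<subseteq> A" for x
    using cm by (auto simp: coarse_map_def)
  obtain C where C: "C \<ge> 0"
      "\<And>x0 x1. dist x0 x1 < infdist x0 A - C \<Longrightarrow> diameter (\<pi> x0 \<union> \<pi> x1) \<le> C"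
      "\<And>x. infdist x (\<pi> x) - infdist x A \<le> C"
    using assms unfolding strongly_contracting_map_def by blast
  define \<rho> where "\<rho> x = (SOME a. a \<in> \<pi> x)" for x
  have \<rho>: "\<rho> x \<in> \<pi> x" for x
    unfolding \<rho>_def using ne by (metis all_not_in_conv someI)
  have "D \<ge> 0"
    using D diameter_ge_0 order_trans by blast
  \<comment> \<open>\<open>D\<close> accounts for the choice of a point in \<open>\<pi> x\<close>,
    and 1 for an infimum that need not be attained.\<close>
  interpret contracting_retraction A \<rho> "C + D + 1"
  proof
    show "0 \<le> C + D + 1"
      using C \<open>D \<ge> 0\<close> by simp
    show "\<rho> x \<in> A" for x
      using \<rho> ne by blast
    show "dist x (\<rho> x) \<le> infdist x A + (C + D + 1)" for x
    proof -
      obtain a where a: "a \<in> \<pi> x" "dist x a < infdist x (\<pi> x) + 1"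
        using infdist_less_obtains[of "\<pi> x" x "infdist x (\<pi> x) + 1"] ne by auto
      have "dist a (\<rho> x) \<le> D"
        using diameter_bounded_bound[OF D(1) a(1) \<rho>] D(2)[of x] by simp
      then show ?thesis
        using a C(3)[of x] dist_triangle[of x "\<rho> x" a] by simp
    qed
    show "dist (\<rho> x) (\<rho> y) \<le> C + D + 1" if "dist x y < infdist x A - (C + D + 1)" for x y
    proof -
      have "diameter (\<pi> x \<union> \<pi> y) \<le> C"
        using that \<open>D \<ge> 0\<close> by (intro C(2)) simp
      moreover have "dist (\<rho> x) (\<rho> y) \<le> diameter (\<pi> x \<union> \<pi> y)"
        using D \<rho> by (intro diameter_bounded_bound) auto
      ultimately show ?thesis using \<open>D \<ge> 0\<close> by simp
    qed
  qed
  show ?thesis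
    using bottleneck[OF geod] C_nonneg by (intro exI[of _ "284 * (C + D + 1) + 84"]) auto
qed

section \<open>A criterion for strong contraction\<close>

sublocale G_space \<subseteq> group G
  using group_hom group_hom.axioms(1) by auto

section \<open>Powers, orbits and translates under the action\<close>

context G_space
begin

lemma act_mult:
  assumes "g \<in> carrier G" "h \<in> carrier G"
  shows "\<phi> (g \<otimes>\<^bsub>G\<^esub> h) x = \<phi> g (\<phi> h x)"
  using assms by (simp add: composition_rule)

lemma act_one [simp]: "\<phi> \<one>\<^bsub>G\<^esub> x = x"
  by (metis UNIV_I id_eq_one restrict_apply)

lemma act_inv [simp]:
  assumes "g \<in> carrier G"
  shows "\<phi> (inv\<^bsub>G\<^esub> g) (\<phi> g x) = x" "\<phi> g (\<phi> (inv\<^bsub>G\<^esub> g) x) = x"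
  using assms by (simp_all flip: act_mult)

lemma act_image_iff:
  assumes "g \<in> carrier G"
  shows "x \<in> \<phi> g ` S \<longleftrightarrow> \<phi> (inv\<^bsub>G\<^esub> g) x \<in> S"
  using assms by (metis act_inv image_iff)

lemma act_pow_add:
  assumes "g \<in> carrier G"
  shows "\<phi> (g [^]\<^bsub>G\<^esub> (i + j :: int)) x = \<phi> (g [^]\<^bsub>G\<^esub> i) (\<phi> (g [^]\<^bsub>G\<^esub> j) x)"
  using assms by (simp add: int_pow_mult act_mult)

lemma dist_act_pow:
  assumes "g \<in> carrier G"
  shows "dist (\<phi> (g [^]\<^bsub>G\<^esub> i) x) (\<phi> (g [^]\<^bsub>G\<^esub> j) x) = dist (\<phi> (g [^]\<^bsub>G\<^esub> (i - j :: int)) x) x"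
  using assms act_pow_add[of g j "i - j" x] by (simp add: isometric)

lemma dist_act_pow_le_nat:
  assumes "g \<in> carrier G"
  shows "dist (\<phi> (g [^]\<^bsub>G\<^esub> (int n)) x) x \<le> real n * dist (\<phi> g x) x"
proof (induction n)
  case (Suc n)
  have "dist (\<phi> (g [^]\<^bsub>G\<^esub> (int (Suc n))) x) x
      \<le> dist (\<phi> (g [^]\<^bsub>G\<^esub> (int (Suc n))) x) (\<phi> (g [^]\<^bsub>G\<^esub> (int n)) x) + dist (\<phi> (g [^]\<^bsub>G\<^esub> (int n)) x) x"
    by (rule dist_triangle)
  also have "dist (\<phi> (g [^]\<^bsub>G\<^esub> (int (Suc n))) x) (\<phi> (g [^]\<^bsub>G\<^esub> (int n)) x) = dist (\<phi> g x) x"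
    using assms by (subst dist_act_pow) auto
  finally show ?case
    using Suc by (simp add: algebra_simps)
qed simp

lemma dist_act_pow_le:
  assumes "g \<in> carrier G"
  shows "dist (\<phi> (g [^]\<^bsub>G\<^esub> i) x) (\<phi> (g [^]\<^bsub>G\<^esub> j) x) \<le> \<bar>real_of_int (i - j)\<bar> * dist (\<phi> g x) x"
proof (cases "j \<le> i")
  case True
  then obtain n where "i - j = int n"
    by (metis diff_ge_0_iff_ge zero_le_imp_eq_int)
  then show ?thesis
    using dist_act_pow_le_nat[OF assms, of n x] by (simp add: dist_act_pow[OF assms])
next
  case False
  then obtain n where "j - i = int n"
    by (metis diff_ge_0_iff_ge linear zero_le_imp_eq_int)
  moreover have "\<bar>real_of_int (i - j)\<bar> = real_of_int (j - i)"
    using False by simp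
  ultimately show ?thesis
    using dist_act_pow_le_nat[OF assms, of n x] dist_act_pow[OF assms, of j x i]
    by (simp only: dist_commute[of "\<phi> (g [^]\<^bsub>G\<^esub> i) x"] of_int_of_nat_eq)
qed

lemma geodesic_on_ex:
  fixes x y :: 'x
  shows "\<exists>\<gamma>. \<gamma> 0 = x \<and> \<gamma> (dist x y) = y \<and> geodesic_on {0..dist x y} \<gamma>"
  using geodesic[of x y] by (simp add: geodesic_on_def)

text \<open>The ball around \<open>y\<close> is taken large enough to contain \<open>x\<close> as
  well, so \<open>\<phi> g x\<close> lies in the ball and in its translate.\<close>

lemma finite_near_translates: "finite {g \<in> carrier G. dist (\<phi> g x) y \<le> r}"
proof (rule finite_subset)
  let ?K = "cball y (max r (dist x y))"
  show "{g \<in> carrier G. dist (\<phi> g x) y \<le> r} \<subseteq> {g \<in> carrier G. \<phi> g ` ?K \<inter> ?K \<noteq> {}}"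
  proof safe
    fix g assume g: "dist (\<phi> g x) y \<le> r" "\<phi> g ` ?K \<inter> ?K = {}"
    have "\<phi> g x \<in> \<phi> g ` ?K \<inter> ?K"
      using g(1) by (auto simp: dist_commute)
    then show False using g(2) by blast
  qed
  show "finite {g \<in> carrier G. \<phi> g ` ?K \<inter> ?K \<noteq> {}}"
    by (intro properly_discontinuous proper)
qed

lemma pow_inj_escapes:
  fixes I :: "int set"
  assumes g: "g \<in> carrier G" and inj: "inj (\<lambda>k::int. g [^]\<^bsub>G\<^esub> k)" and "infinite I"
  shows "\<exists>k\<in>I. dist (\<phi> (g [^]\<^bsub>G\<^esub> k) x) y > r"
proof (rule ccontr)
  assume "\<not> ?thesis"
  then have "(\<lambda>k. g [^]\<^bsub>G\<^esub> k) ` I \<subseteq> {f \<in> carrier G. dist (\<phi> f x) y \<le> r}"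
    using g by (auto simp: not_less)
  then have "finite ((\<lambda>k. g [^]\<^bsub>G\<^esub> k) ` I)"
    using finite_near_translates finite_subset by blast
  then show False
    using \<open>infinite I\<close> inj by (metis finite_imageD inj_on_subset subset_UNIV)
qed

lemma near_proj_act:
  assumes "g \<in> carrier G"
  shows "near_proj (\<phi> g ` A) (\<phi> g x) (\<phi> g a) \<longleftrightarrow> near_proj A x a"
proof -
  have "\<phi> g a \<in> \<phi> g ` A \<longleftrightarrow> a \<in> A"
    using assms by (simp add: act_image_iff)
  then show ?thesis
    using assms by (auto simp: near_proj_def isometric)
qed

lemma near_proj_act_iff:
  assumes "g \<in> carrier G"
  shows "near_proj (\<phi> g ` A) x a \<longleftrightarrow> near_proj A (\<phi> (inv\<^bsub>G\<^esub> g) x) (\<phi> (inv\<^bsub>G\<^esub> g) a)"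
  using near_proj_act[OF assms, of A "\<phi> (inv\<^bsub>G\<^esub> g) x" "\<phi> (inv\<^bsub>G\<^esub> g) a"] assms by simp

lemma bottleneck_act:
  assumes g: "g \<in> carrier G" and "bottleneck A C"
  shows "bottleneck (\<phi> g ` A) C"
  unfolding bottleneck_def near_proj_act_iff[OF g]
proof (intro allI impI)
  fix x y a b
  let ?f = "\<phi> (inv\<^bsub>G\<^esub> g)"
  assume "near_proj A (?f x) (?f a)" "near_proj A (?f y) (?f b)"
  then have "dist (?f a) (?f b) \<le> C \<or>
      dist (?f x) (?f a) + dist (?f a) (?f b) + dist (?f b) (?f y) \<le> dist (?f x) (?f y) + C"
    using assms(2) unfolding bottleneck_def by blast
  then show "dist a b \<le> C \<or> dist x a + dist a b + dist b y \<le> dist x y + C"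
    using g by (simp add: isometric)
qed

end

text \<open>
  The translates \<open>g\<^sup>k U\<close> form a chain of half-spaces, and any path from \<open>g\<^sup>k U\<close> to the complement
  of \<open>g\<^sup>k\<^sup>+\<^sup>1 U\<close> has to pass near \<open>g\<^sup>k p\<close>. Sending \<open>x\<close> to the orbit point at which it leaves
  the chain is then a strongly contracting projection to the orbit of \<open>p\<close>.
\<close>

locale separating_translate = G_space G \<phi>
  for G (structure) and \<phi> :: "'g \<Rightarrow> 'x::metric_space \<Rightarrow> 'x" +
  fixes g :: 'g and U :: "'x set" and p b :: 'x and D :: real
  assumes g_in [simp]: "g \<in> carrier G"
    and U_subset: "U \<subseteq> \<phi> g ` U"
    and b: "b \<in> \<phi> g ` U" "b \<notin> U"
    and separation: "x \<in> U \<Longrightarrow> y \<notin> \<phi> g ` U \<Longrightarrow> dist x p + dist p y \<le> dist x y + D"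
begin

text \<open>The translate of \<open>U\<close> by \<open>g [^] k\<close>, written as a preimage so
  that membership unfolds without an existential.\<close>

definition V :: "int \<Rightarrow> 'x set" where
  "V k = {x. \<phi> (g [^] (-k)) x \<in> U}"

lemma V_0: "V 0 = U"
  by (simp add: V_def)

lemma V_Suc: "x \<in> V (k + 1) \<longleftrightarrow> \<phi> (g [^] (-k)) x \<in> \<phi> g ` U"
proof -
  have "\<phi> (inv g) (\<phi> (g [^] (-k)) x) = \<phi> (g [^] (-1 + -k)) x"
    using act_pow_add[of g "-1" "-k" x] by (simp add: int_pow_neg[of g 1])
  then show ?thesis
    by (simp add: V_def act_image_iff algebra_simps)
qed

lemma V_mono_Suc: "V k \<subseteq> V (k + 1)"
  using U_subset by (auto simp: V_Suc) (auto simp: V_def)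

lemma V_mono:
  assumes "i \<le> j"
  shows "V i \<subseteq> V j"
  using assms
proof (induction j rule: int_ge_induct)
  case (step j)
  then show ?case using V_mono_Suc by blast
qed simp

lemma act_pow_V: "\<phi> (g [^] j) x \<in> V k \<longleftrightarrow> x \<in> V (k - j)"
  using act_pow_add[of g "-k" j x] by (simp add: V_def)

lemma V_separation:
  assumes "x \<in> V k" "y \<notin> V (k + 1)"
  shows "dist x (\<phi> (g [^] k) p) + dist (\<phi> (g [^] k) p) y \<le> dist x y + D"
proof -
  let ?f = "\<phi> (g [^] (-k))"
  have "dist (?f x) p + dist p (?f y) \<le> dist (?f x) (?f y) + D"
    using assms(1) assms(2)[unfolded V_Suc] by (intro separation) (simp_all add: V_def)
  moreover have "?f (\<phi> (g [^] k) p) = p"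
    using act_pow_add[of g "-k" k p] by simp
  ultimately show ?thesis
    by (metis g_in int_pow_closed isometric)
qed

text \<open>A relation would make the chain periodic, whereas \<open>b\<close> lies in
  \<open>V 1\<close> but not in \<open>V 0\<close>.\<close>

lemma pow_eq_one:
  assumes "g [^] (k::int) = \<one>"
  shows "k = 0"
proof (rule ccontr)
  assume "k \<noteq> 0"
  have "b \<in> V 1" "b \<notin> V 0"
    using b V_Suc[of b 0] by (simp_all add: V_0)
  have shift: "b \<in> V (k' + 0) \<longleftrightarrow> b \<in> V 0" if "g [^] (k'::int) = \<one>" for k'
    using act_pow_V[of k' b "k'"] that by simp
  have "g [^] (-k) = \<one>"
    using assms by (simp add: int_pow_neg)
  then have "b \<notin> V \<bar>k\<bar>"
    using shift[of k] shift[of "-k"] assms \<open>b \<notin> V 0\<close> by (auto simp: abs_if)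
  moreover have "V 1 \<subseteq> V \<bar>k\<bar>"
    using \<open>k \<noteq> 0\<close> by (intro V_mono) simp
  ultimately show False
    using \<open>b \<in> V 1\<close> by blast
qed

lemma pow_inj: "inj (\<lambda>k::int. g [^] k)"
proof (rule injI)
  fix i j :: int
  assume "g [^] i = g [^] j"
  then have "g [^] (i - j) = \<one>"
    by (simp add: int_pow_diff)
  then show "i = j" using pow_eq_one by fastforce
qed

text \<open>If \<open>x\<close> were in no member of the chain, every \<open>g [^] k\<close> with
  \<open>k \<ge> 1\<close> would separate \<open>b\<close> from \<open>x\<close> and keep its orbit
  point within \<open>dist b x + D\<close> of \<open>b\<close>, against
  \<open>pow_inj_escapes\<close>. Negative powers exclude membership in all. Monotonicity then gives
  a transition.\<close>

lemma index_exists: "\<exists>i. x \<notin> V i \<and> x \<in> V (i + 1)"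
proof -
  have b1: "b \<in> V 1" "b \<notin> V 0"
    using b V_Suc[of b 0] by (simp_all add: V_0)
  have "\<exists>k. x \<in> V k"
  proof (rule ccontr)
    assume none: "\<not> ?thesis"
    obtain k :: int where k: "k \<ge> 1" "dist (\<phi> (g [^] k) p) b > dist b x + D"
      using pow_inj_escapes[OF g_in pow_inj infinite_Ici[of 1], where x = p and y = b and r = "dist b x + D"]
      by auto
    have "b \<in> V k"
      using b1 V_mono[OF k(1)] by blast
    then have "dist b (\<phi> (g [^] k) p) + dist (\<phi> (g [^] k) p) x \<le> dist b x + D"
      using none by (intro V_separation) auto
    then show False
      using k(2) zero_le_dist[of "\<phi> (g [^] k) p" x] dist_commute[of b "\<phi> (g [^] k) p"] by linarith
  qed
  then obtain k1 where k1: "x \<in> V k1" by blast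
  have "\<exists>k. x \<notin> V k"
  proof (rule ccontr)
    assume all: "\<not> ?thesis"
    obtain k :: int where k: "k \<le> -1" "dist (\<phi> (g [^] k) p) b > dist x b + D"
      using pow_inj_escapes[OF g_in pow_inj infinite_Iic[of "-1"], where x = p and y = b and r = "dist x b + D"]
      by auto
    have "b \<notin> V (k + 1)"
      using b1 V_mono[of "k + 1" 0] k(1) by auto
    then have "dist x (\<phi> (g [^] k) p) + dist (\<phi> (g [^] k) p) b \<le> dist x b + D"
      using all by (intro V_separation) auto
    then show False
      using k(2) zero_le_dist[of x "\<phi> (g [^] k) p"] by linarith
  qed
  then obtain k0 where k0: "x \<notin> V k0" by blast
  show ?thesis
  proof (rule ccontr)
    assume "\<not> ?thesis"
    then have step: "x \<notin> V (i + 1)" if "x \<notin> V i" for i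
      using that by blast
    have "x \<notin> V i" if "k0 \<le> i" for i
      using that by (induction i rule: int_ge_induct) (use k0 step in auto)
    moreover have "x \<in> V (max k0 k1)"
      using k1 V_mono[of k1 "max k0 k1"] by auto
    ultimately show False by simp
  qed
qed

text \<open>A coarse coordinate along the chain. Later arguments reach it through
  \<open>index_less_iff\<close>, which also gives uniqueness.\<close>

definition index :: "'x \<Rightarrow> int" where
  "index x = (SOME i. x \<notin> V i \<and> x \<in> V (i + 1))"

lemma index_less_iff: "index x < k \<longleftrightarrow> x \<in> V k"
proof -
  have i: "x \<notin> V (index x)" "x \<in> V (index x + 1)"
    using someI_ex[OF index_exists[of x]] by (simp_all add: index_def)
  show ?thesis
  proof
    assume "index x < k"
    then show "x \<in> V k" using i V_mono[of "index x + 1" k] by auto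
  next
    assume "x \<in> V k"
    then show "index x < k" using i V_mono[of k "index x"] by force
  qed
qed

lemma index_act_pow [simp]: "index (\<phi> (g [^] j) x) = index x + j"
proof -
  have "index (\<phi> (g [^] j) x) < k \<longleftrightarrow> index x + j < k" for k
    using act_pow_V[of j x k] by (simp add: index_less_iff[symmetric] less_diff_eq)
  \<comment> \<open>Integers with the same strict upper bounds agree; each one is tested as a
    bound.\<close>
  from this[of "index x + j"] this[of "index (\<phi> (g [^] j) x)"] show ?thesis
    by simp
qed

lemma index_separation:
  assumes "index x < k" "k < index y"
  shows "dist x (\<phi> (g [^] k) p) + dist (\<phi> (g [^] k) p) y \<le> dist x y + D"
proof (rule V_separation)
  show "x \<in> V k" using assms by (simp add: index_less_iff)
  show "y \<notin> V (k + 1)" using assms by (simp flip: index_less_iff)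
qed

section \<open>The projection to the orbit and its contraction\<close>

abbreviation step :: real where "step \<equiv> dist (\<phi> g p) p"

lemma dist_orbit_le: "dist (\<phi> (g [^] (i::int)) p) (\<phi> (g [^] (j::int)) p) \<le> \<bar>real_of_int (i - j)\<bar> * step"
  by (rule dist_act_pow_le) simp

lemma dist_orbit_adjacent:
  fixes i j :: int
  assumes "\<bar>i - j\<bar> \<le> 1"
  shows "dist (\<phi> (g [^] i) p) (\<phi> (g [^] j) p) \<le> step"
proof -
  have "\<bar>real_of_int (i - j)\<bar> \<le> 1"
    using assms by linarith
  then show ?thesis
    using dist_orbit_le[of i j] mult_right_mono[of "\<bar>real_of_int (i - j)\<bar>" 1 step] by simp
qed

text \<open>The indices of \<open>b\<close> and its translate by the square of \<open>g\<close>
  differ by 2, so separation applies between them; with negative \<open>D\<close> it would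
  contradict the triangle inequality.\<close>

lemma D_nonneg: "0 \<le> D"
proof -
  have "index b < index b + 1" "index b + 1 < index (\<phi> (g [^] (2::int)) b)"
    by simp_all
  from index_separation[OF this] show ?thesis
    using dist_triangle[of b "\<phi> (g [^] (2::int)) b" "\<phi> (g [^] (index b + 1)) p"] by linarith
qed

definition orbit_map :: "'x \<Rightarrow> 'x set" where
  "orbit_map x = {\<phi> (g [^] index x) p}"

definition axis :: "'x set" where
  "axis = range (\<lambda>k::int. \<phi> (g [^] k) p)"

text \<open>If the indices of \<open>x\<close> and \<open>?y\<close> differ by more than 1, the
  orbit point one step from \<open>index x\<close> towards \<open>?y\<close> separates them and is
  no farther from \<open>x\<close> than \<open>?y\<close>, up to \<open>D\<close>. Otherwise
  \<open>?y\<close> is near the chosen orbit point; \<open>index p\<close> enters because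
  \<open>?y\<close> has index \<open>index p + k\<close>.\<close>

lemma dist_index_orbit:
  fixes k :: int
  shows "dist x (\<phi> (g [^] index x) p) \<le> dist x (\<phi> (g [^] k) p) + D + (1 + \<bar>real_of_int (index p)\<bar>) * step"
proof -
  let ?i = "index x" and ?y = "\<phi> (g [^] k) p"
  have iy: "index ?y = index p + k" by simp
  have sp: "step \<le> (1 + \<bar>real_of_int (index p)\<bar>) * step"
    by (simp add: algebra_simps)
  consider "?i + 1 < index ?y" | "index ?y < ?i - 1" | "\<bar>index ?y - ?i\<bar> \<le> 1" by linarith
  then show ?thesis
  proof cases
    case 1
    have "dist x (\<phi> (g [^] (?i + 1)) p) \<le> dist x ?y + D"
      using index_separation[of x "?i + 1" ?y] 1 zero_le_dist[of "\<phi> (g [^] (?i + 1)) p" ?y] by linarith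
    moreover have "dist (\<phi> (g [^] (?i + 1)) p) (\<phi> (g [^] ?i) p) \<le> step"
      by (rule dist_orbit_adjacent) simp
    ultimately show ?thesis
      using sp dist_triangle[of x "\<phi> (g [^] ?i) p" "\<phi> (g [^] (?i + 1)) p"] by linarith
  next
    case 2
    have "dist x (\<phi> (g [^] (?i - 1)) p) \<le> dist x ?y + D"
      using index_separation[of ?y "?i - 1" x] 2 zero_le_dist[of ?y "\<phi> (g [^] (?i - 1)) p"]
        dist_commute[of ?y x] dist_commute[of "\<phi> (g [^] (?i - 1)) p" x] by linarith
    moreover have "dist (\<phi> (g [^] (?i - 1)) p) (\<phi> (g [^] ?i) p) \<le> step"
      by (rule dist_orbit_adjacent) simp
    ultimately show ?thesis
      using sp dist_triangle[of x "\<phi> (g [^] ?i) p" "\<phi> (g [^] (?i - 1)) p"] by linarith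
  next
    case 3
    then have "\<bar>k - ?i\<bar> \<le> 1 + \<bar>index p\<bar>"
      using iy by linarith
    then have "\<bar>real_of_int (k - ?i)\<bar> \<le> 1 + \<bar>real_of_int (index p)\<bar>"
      by linarith
    from mult_right_mono[OF this zero_le_dist]
    have "dist ?y (\<phi> (g [^] ?i) p) \<le> (1 + \<bar>real_of_int (index p)\<bar>) * step"
      by (rule order_trans[OF dist_orbit_le])
    then show ?thesis
      using dist_triangle[of x "\<phi> (g [^] ?i) p" ?y] D_nonneg by linarith
  qed
qed

text \<open>Indices more than 1 apart leave room for an orbit point separating \<open>x\<close> from
  \<open>y\<close>, which puts \<open>x\<close> within \<open>dist x y + D\<close> of the
  axis.\<close>

lemma orbit_map_contraction:
  assumes "dist x y < infdist x axis - D"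
  shows "dist (\<phi> (g [^] index x) p) (\<phi> (g [^] index y) p) \<le> step"
proof (rule dist_orbit_adjacent, rule ccontr)
  let ?i = "index x"
  assume "\<not> \<bar>?i - index y\<bar> \<le> 1"
  then consider "?i + 1 < index y" | "index y < ?i - 1" by linarith
  then have "\<exists>k::int. dist x (\<phi> (g [^] k) p) \<le> dist x y + D"
  proof cases
    case 1
    then show ?thesis
      using index_separation[of x "?i + 1" y] zero_le_dist[of "\<phi> (g [^] (?i + 1)) p" y]
      by (intro exI[of _ "?i + 1"]) linarith
  next
    case 2
    then show ?thesis
      using index_separation[of y "?i - 1" x] zero_le_dist[of y "\<phi> (g [^] (?i - 1)) p"]
        dist_commute[of y x] dist_commute[of "\<phi> (g [^] (?i - 1)) p" x]
      by (intro exI[of _ "?i - 1"]) linarith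
  qed
  then obtain k :: int where "dist x (\<phi> (g [^] k) p) \<le> dist x y + D" by blast
  moreover have "infdist x axis \<le> dist x (\<phi> (g [^] k) p)"
    by (intro infdist_le) (simp add: axis_def)
  ultimately show False using assms by linarith
qed

lemma strongly_contracting_orbit_map: "strongly_contracting_map axis orbit_map"
proof -
  define C where "C = D + (1 + \<bar>real_of_int (index p)\<bar>) * step"
  have sp: "step \<le> (1 + \<bar>real_of_int (index p)\<bar>) * step"
    by (simp add: algebra_simps)
  have C: "C \<ge> 0" "D \<le> C" "step \<le> C"
    using D_nonneg sp zero_le_dist[of "\<phi> g p" p] unfolding C_def by linarith+
  have "coarse_map axis orbit_map"
    by (auto simp: coarse_map_def orbit_map_def axis_def intro!: exI[of _ 0])
  moreover have "orbit_map a \<subseteq> closed_neighborhood C {a} \<and> {a} \<subseteq> closed_neighborhood C (orbit_map a)"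
    if a: "a \<in> axis" for a
  proof -
    obtain k :: int where "a = \<phi> (g [^] k) p"
      using a unfolding axis_def by blast
    then show ?thesis
      using dist_index_orbit[of a k]
      by (simp add: orbit_map_def closed_neighborhood_def C_def dist_commute)
  qed
  moreover have "diameter (orbit_map x \<union> orbit_map y) \<le> C" if "dist x y < infdist x axis - C" for x y
  proof -
    have "dist (\<phi> (g [^] index x) p) (\<phi> (g [^] index y) p) \<le> C"
      using orbit_map_contraction[of x y] that C by linarith
    then have le: "dist u v \<le> C" if "u \<in> orbit_map x \<union> orbit_map y" "v \<in> orbit_map x \<union> orbit_map y" for u v
      using that C by (auto simp: orbit_map_def dist_commute)
    have "orbit_map x \<noteq> {}"
      by (simp add: orbit_map_def)
    then have "(SUP (u, v)\<in>(orbit_map x \<union> orbit_map y) \<times> (orbit_map x \<union> orbit_map y). dist u v) \<le> C"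
      using le by (intro cSUP_least) auto
    then show ?thesis
      using C by (simp add: diameter_def)
  qed
  moreover have "infdist x (orbit_map x) - infdist x axis \<le> C" for x
  proof -
    have "dist x (\<phi> (g [^] index x) p) - C \<le> infdist x axis"
      unfolding axis_def infdist_notempty[of "range _", simplified]
      using dist_index_orbit[of x] by (intro cINF_greatest) (auto simp: C_def algebra_simps)
    then show ?thesis by (simp add: orbit_map_def)
  qed
  ultimately show ?thesis
    using C(1) unfolding strongly_contracting_map_def by blast
qed

lemma cocompact_axis: "acts_cocompactly_on \<phi> (generate G {g}) axis"
  unfolding acts_cocompactly_on_def
proof (intro exI conjI)
  show "compact {p}" by simp
  have "\<phi> (g [^] (0::int)) p \<in> axis" unfolding axis_def by (rule rangeI)
  then show "{p} \<subseteq> axis" by simp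
  show "(\<Union>h\<in>generate G {g}. \<phi> h ` {p}) = axis"
    by (auto simp: generate_pow axis_def)
qed

text \<open>The orbit point with exponent \<open>index p + m\<close> separates \<open>p\<close> from
  its translate by \<open>g [^] (m + n)\<close>. Replacing it by the one with exponent
  \<open>m\<close> causes the last error term.\<close>

lemma orbit_superadditive:
  fixes m n :: nat
  shows "dist (\<phi> (g [^] int m) p) p + dist (\<phi> (g [^] int n) p) p
    \<le> dist (\<phi> (g [^] int (m + n)) p) p + D + 2 * (\<bar>real_of_int (index p)\<bar> * step)"
proof -
  let ?o = "\<lambda>k::int. \<phi> (g [^] k) p" and ?i = "index p"
  have o0: "?o 0 = p" by simp
  have nn: "0 \<le> \<bar>real_of_int ?i\<bar> * step" by simp
  show ?thesis
  proof (cases "m = 0 \<or> n = 0")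
    case True
    then show ?thesis using D_nonneg nn by auto
  next
    case False
    have "dist p (?o (?i + int m)) + dist (?o (?i + int m)) (?o (int (m + n))) \<le> dist p (?o (int (m + n))) + D"
      using False by (intro index_separation) auto
    moreover have "dist (?o (?i + int m)) (?o (int m)) \<le> \<bar>real_of_int ?i\<bar> * step"
      using dist_orbit_le[of "?i + int m" "int m"] by simp
    moreover have "dist (?o (int m)) (?o (int (m + n))) = dist (?o (int n)) p"
      using dist_act_pow[OF g_in, of "int (m + n)" p "int m"] by (simp add: dist_commute)
    ultimately show ?thesis
      using dist_triangle[of p "?o (int m)" "?o (?i + int m)"]
        dist_triangle3[of "?o (int m)" "?o (int (m + n))" "?o (?i + int m)"]
      by (simp add: dist_commute)
  qed
qed

text \<open>Some power \<open>s\<close> displaces \<open>p\<close> by more than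
  \<open>E + 1\<close>, where \<open>E\<close> is the loss in \<open>orbit_superadditive\<close>, so
  each further block of \<open>s\<close> steps gains at least 1. Division by \<open>s\<close>
  handles the remaining exponents.\<close>

lemma quasi_geodesic_orbit: "quasi_geodesic (\<lambda>i::int. \<phi> (g [^] i) p)"
proof -
  let ?o = "\<lambda>k::int. \<phi> (g [^] k) p"
  define E where "E = D + 2 * (\<bar>real_of_int (index p)\<bar> * step)"
  obtain s0 where s0: "s0 \<ge> (1::int)" "dist (?o s0) p > E + 1"
    using pow_inj_escapes[OF g_in pow_inj infinite_Ici[of 1], where x = p and y = p and r = "E + 1"] by auto
  define s where "s = nat s0"
  have s: "s \<ge> 1" "dist (?o (int s)) p > E + 1"
    using s0 by (simp_all add: s_def)
  have mult: "real k \<le> dist (?o (int (k * s))) p" for k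
  proof (induction k)
    case (Suc k)
    then show ?case
      using orbit_superadditive[of s "k * s"] s by (simp add: E_def algebra_simps)
  qed simp
  have lower: "real n / real s - (1 + real s * step) \<le> dist (?o (int n)) p" for n
  proof -
    define k where "k = n div s"
    have n: "k * s \<le> n" "n < k * s + s"
      using s(1) dividend_less_div_times[of s n] by (simp_all add: k_def)
    have "real n < (real k + 1) * real s"
      using n(2) by (simp add: algebra_simps flip: of_nat_mult of_nat_add)
    then have "real n / real s < real k + 1"
      using s(1) by (simp add: divide_less_eq)
    moreover have "dist (?o (int (k * s))) (?o (int n)) \<le> real s * step"
    proof -
      have "\<bar>real_of_int (int (k * s) - int n)\<bar> \<le> real s"
        using n by linarith
      from mult_right_mono[OF this zero_le_dist] show ?thesis
        by (rule order_trans[OF dist_orbit_le])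
    qed
    ultimately show ?thesis
      using mult[of k] dist_triangle[of "?o (int (k * s))" p "?o (int n)"] by linarith
  qed
  define L where "L = max (real s) step"
  define B where "B = 1 + real s * step"
  have LB: "L \<ge> 1" "B \<ge> 0"
    using s(1) by (auto simp: L_def B_def)
  have "\<bar>real_of_int (i - j)\<bar> / L - B \<le> dist (?o i) (?o j)" for i j
  proof -
    have "dist (?o i) (?o j) = dist (?o (int (nat \<bar>i - j\<bar>))) p"
      using dist_act_pow[OF g_in, of i p j] dist_act_pow[OF g_in, of j p i]
      by (cases "i \<ge> j") (auto simp: dist_commute)
    moreover have "\<bar>real_of_int (i - j)\<bar> / L \<le> real (nat \<bar>i - j\<bar>) / real s"
      using s(1) by (simp add: L_def frac_le)
    ultimately show ?thesis
      using lower[of "nat \<bar>i - j\<bar>"] by (simp add: B_def)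
  qed
  moreover have "dist (?o i) (?o j) \<le> L * \<bar>real_of_int (i - j)\<bar> + B" for i j
  proof -
    have "\<bar>real_of_int (i - j)\<bar> * step \<le> L * \<bar>real_of_int (i - j)\<bar>"
      by (subst mult.commute, intro mult_right_mono) (auto simp: L_def)
    then show ?thesis
      using dist_orbit_le[of i j] LB by linarith
  qed
  ultimately show ?thesis
    unfolding quasi_geodesic_def using LB by blast
qed

lemma strongly_contracting: "strongly_contracting_element G \<phi> p g"
  unfolding strongly_contracting_element_def
  using quasi_geodesic_orbit cocompact_axis strongly_contracting_orbit_map by auto

end

section \<open>Translates of a contracting axis\<close>

text \<open>Since \<open>a\<close> and \<open>b\<close> are more than \<open>2 * C\<close> apart,
  \<open>c\<close> is farther than \<open>C\<close> from one of them, and the bottleneck applies on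
  that side of \<open>z\<close>. The bounds on \<open>dist x a\<close> and \<open>dist b y\<close>
  place \<open>z\<close> between entry and exit.\<close>

lemma bottleneck_between:
  assumes bn: "bottleneck A C" and "0 \<le> C"
    and "near_proj A x a" "near_proj A y b" "near_proj A z c"
    and z: "dist x z + dist z y = dist x y" "dist x a \<le> dist x z" "dist b y \<le> dist z y"
    and "dist a b > 2 * C"
  shows "dist z c \<le> 2 * C"
proof -
  have 1: "dist x a + dist a c + dist c z \<le> dist x z + C" if "dist a c > C"
    using assms that by (intro bottleneckD) auto
  have 2: "dist z c + dist c b + dist b y \<le> dist z y + C" if "dist c b > C"
    using assms that by (intro bottleneckD) auto
  have 3: "dist x y \<le> dist x a + dist a b + dist b y" "dist a b \<le> dist a c + dist c b"
    using dist_triangle[of x y a] dist_triangle[of a y b] dist_triangle[of a b c] by linarith+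
  show ?thesis
    using 1 2 3 z assms(2) \<open>dist a b > 2 * C\<close> dist_commute[of c z] by linarith
qed

text \<open>Points of \<open>A\<close> are their own near projections, so
  \<open>bottleneck_between\<close> covers long segments. On short ones \<open>x\<close> itself is
  close to \<open>z\<close>.\<close>

lemma bottleneck_quasiconvex:
  assumes bn: "bottleneck A C" and "0 \<le> C" and xy: "x \<in> A" "y \<in> A"
    and c: "near_proj A z c" and z: "dist x z + dist z y = dist x y"
  shows "dist z c \<le> 2 * C + 1"
proof (cases "dist x y > 2 * C")
  case True
  have "near_proj A x x" "near_proj A y y"
    using xy by (auto simp: near_proj_def)
  then show ?thesis
    using bottleneck_between[OF bn \<open>0 \<le> C\<close> _ _ c z] True by fastforce
next
  case False
  have "dist z c \<le> dist x z + 1"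
    using near_projD(2)[OF c xy(1)] by (simp add: dist_commute)
  then show ?thesis
    using False z zero_le_dist[of z y] by linarith
qed

section \<open>Mutual projections of two sets\<close>

definition projection_bound :: "'a::metric_space set \<Rightarrow> 'a set \<Rightarrow> real \<Rightarrow> bool" where
  "projection_bound A B M \<longleftrightarrow>
     (\<forall>u\<in>B. \<forall>v\<in>B. \<forall>a b. near_proj A u a \<longrightarrow> near_proj A v b \<longrightarrow> dist a b \<le> M)"

lemma projection_boundD:
  assumes "projection_bound A B M" "u \<in> B" "v \<in> B" "near_proj A u a" "near_proj A v b"
  shows "dist a b \<le> M"
  using assms unfolding projection_bound_def by blast

lemma projection_bound_mono:
  assumes "projection_bound A B M" "M \<le> M'"
  shows "projection_bound A B M'"
  using assms unfolding projection_bound_def by (meson order_trans)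

text \<open>If \<open>b\<close> is far from \<open>\<beta>\<close>, it is far from the projection
  \<open>c\<close> of \<open>a\<close> to \<open>B\<close>, so going from \<open>x\<close> to
  \<open>a\<close> means passing near \<open>b\<close> and \<open>c\<close>. The projection
  \<open>e\<close> of \<open>c\<close> to \<open>A\<close> is near \<open>\<alpha>\<close>. Were
  \<open>e\<close> far from \<open>a\<close>, going from \<open>x\<close> to \<open>c\<close> would
  in turn mean passing near \<open>a\<close>; the two bounds are incompatible.\<close>

lemma behrstock_inequality:
  assumes bnA: "bottleneck A C" and bnB: "bottleneck B C" and "0 \<le> C"
    and MA: "projection_bound A B M" and MB: "projection_bound B A M"
    and x: "near_proj A x a" "near_proj B x b"
    and \<alpha>: "b0 \<in> B" "near_proj A b0 \<alpha>" and \<beta>: "a0 \<in> A" "near_proj B a0 \<beta>"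
  shows "dist a \<alpha> \<le> 2 * C + M \<or> dist b \<beta> \<le> 2 * C + M"
proof (rule disjCI)
  assume "\<not> dist b \<beta> \<le> 2 * C + M"
  then have far: "dist b \<beta> > 2 * C + M" by simp
  obtain c where c: "near_proj B a c"
    using near_proj_exists near_projD(1)[OF x(2)] by blast
  have "dist c \<beta> \<le> M"
    using projection_boundD[OF MB near_projD(1)[OF x(1)] \<beta>(1) c \<beta>(2)] .
  then have bc: "dist b c > 2 * C"
    using far dist_triangle[of b \<beta> c] by linarith
  then have 1: "dist x b + dist b c + dist c a \<le> dist x a + C"
    using bnB x(2) c \<open>0 \<le> C\<close> by (intro bottleneckD) auto
  have cB: "c \<in> B"
    using near_projD(1)[OF c] .
  obtain e where e: "near_proj A c e"
    using near_proj_exists near_projD(1)[OF x(1)] by blast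
  have "dist e \<alpha> \<le> M"
    using projection_boundD[OF MA cB \<alpha>(1) e \<alpha>(2)] .
  moreover have "dist a e \<le> 2 * C"
  proof (rule ccontr)
    assume ae: "\<not> dist a e \<le> 2 * C"
    then have "dist x a + dist a e + dist e c \<le> dist x c + C"
      using bnA x(1) e \<open>0 \<le> C\<close> by (intro bottleneckD) auto
    then show False
      using 1 ae dist_triangle[of x c b] zero_le_dist[of e c] zero_le_dist[of c a] by linarith
  qed
  ultimately show "dist a \<alpha> \<le> 2 * C + M"
    using dist_triangle[of a \<alpha> e] by linarith
qed

text \<open>What is retained of a strongly contracting \<open>h\<close>: \<open>R\<close> comes from
  cocompactness, and \<open>orbit_escapes\<close> is the qualitative form of the lower
  quasi-geodesic bound. The point \<open>p\<close> need not lie in \<open>A\<close>.\<close>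

locale contracting_axis = G_space G \<phi>
  for G (structure) and \<phi> :: "'g \<Rightarrow> 'x::metric_space \<Rightarrow> 'x" +
  fixes h :: 'g and A :: "'x set" and p :: 'x and C R :: real
  assumes h_in [simp]: "h \<in> carrier G"
    and A_nonempty: "A \<noteq> {}"
    and A_invariant: "\<phi> h ` A = A"
    and bottleneck_A: "bottleneck A C"
    and C_nonneg: "0 \<le> C"
    and orbit_coarsely_dense: "a \<in> A \<Longrightarrow> \<exists>k::int. dist a (\<phi> (h [^] k) p) \<le> R"
    and orbit_escapes: "\<exists>k0. \<forall>k::int. k0 \<le> \<bar>k\<bar> \<longrightarrow> r < dist (\<phi> (h [^] k) p) p"
begin

section \<open>Symmetries of the axis and commensuration\<close>

lemma R_nonneg: "0 \<le> R"
  using A_nonempty orbit_coarsely_dense zero_le_dist order_trans by blast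

lemma pow_in_A: "a \<in> A \<Longrightarrow> \<phi> (h [^] (k::int)) a \<in> A"
proof (induction k rule: int_induct[where k = 0])
  case (step1 i)
  then show ?case
    using act_pow_add[of h 1 i a] A_invariant by (auto simp: add.commute)
next
  case (step2 i)
  then obtain b where "b \<in> A" "\<phi> (h [^] i) a = \<phi> h b"
    using A_invariant by blast
  then show ?case
    using act_pow_add[of h "-1" i a] by (simp add: int_pow_neg[of h 1])
qed simp

lemma pow_image_A: "\<phi> (h [^] (k::int)) ` A = A"
proof
  show "\<phi> (h [^] k) ` A \<subseteq> A" using pow_in_A by blast
  show "A \<subseteq> \<phi> (h [^] k) ` A"
    using pow_in_A[of _ "-k"] by (auto simp: act_image_iff int_pow_neg)
qed

lemma near_proj_pow: "near_proj A (\<phi> (h [^] (k::int)) x) (\<phi> (h [^] k) a) \<longleftrightarrow> near_proj A x a"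
  using near_proj_act[of "h [^] k" A x a] by (simp add: pow_image_A)

lemma pow_escapes: "\<exists>k0. \<forall>k::int. k0 \<le> \<bar>k\<bar> \<longrightarrow> r < dist (\<phi> (h [^] k) x) y"
proof -
  obtain k0 where k0: "\<And>k::int. k0 \<le> \<bar>k\<bar> \<Longrightarrow> dist p x + r + dist y p < dist (\<phi> (h [^] k) p) p"
    using orbit_escapes by blast
  have "r < dist (\<phi> (h [^] k) x) y" if "k0 \<le> \<bar>k\<bar>" for k :: int
  proof -
    have "dist (\<phi> (h [^] k) p) (\<phi> (h [^] k) x) = dist p x"
      by (simp add: isometric)
    then show ?thesis
      using k0[OF that] dist_triangle[of "\<phi> (h [^] k) p" p "\<phi> (h [^] k) x"]
        dist_triangle[of "\<phi> (h [^] k) x" p y] by linarith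
  qed
  then show ?thesis by blast
qed

text \<open>Since \<open>h\<close> has infinite order by \<open>orbit_escapes\<close>, this says
  that the cyclic group of \<open>h\<close> and its conjugate by \<open>n\<close> are
  commensurable.\<close>

definition commensurates :: "'g \<Rightarrow> bool" where
  "commensurates n \<longleftrightarrow> (\<exists>(i::int) (j::int). i \<noteq> 0 \<and> j \<noteq> 0 \<and> n \<otimes> h [^] i = h [^] j \<otimes> n)"

lemma commensurates_inv:
  assumes n: "n \<in> carrier G" and "commensurates (inv n)"
  shows "commensurates n"
proof -
  obtain i j :: int where ij: "i \<noteq> 0" "j \<noteq> 0" "inv n \<otimes> h [^] i = h [^] j \<otimes> inv n"
    using assms by (auto simp: commensurates_def)
  have "n \<otimes> h [^] j = n \<otimes> (h [^] j \<otimes> inv n) \<otimes> n"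
    using n by (simp add: m_assoc)
  also have "\<dots> = n \<otimes> (inv n \<otimes> h [^] i) \<otimes> n"
    by (simp add: ij(3))
  also have "\<dots> = h [^] i \<otimes> n"
    using n by (simp flip: m_assoc)
  finally show ?thesis
    using ij unfolding commensurates_def by blast
qed

lemma coset_eq_conj:
  assumes n: "n \<in> carrier G"
    and eq: "h [^] (-i) \<otimes> n \<otimes> h [^] j = h [^] (-i') \<otimes> n \<otimes> h [^] (j'::int)"
  shows "n \<otimes> h [^] (j - j') = h [^] (i - i' :: int) \<otimes> n"
proof -
  have "n \<otimes> h [^] (j - j') = h [^] i \<otimes> (h [^] (-i) \<otimes> n \<otimes> h [^] j) \<otimes> h [^] (-j')"
    using n by (simp add: m_assoc int_pow_mult[symmetric]) (simp add: int_pow_mult[symmetric] m_assoc[symmetric])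
  also have "\<dots> = h [^] i \<otimes> (h [^] (-i') \<otimes> n \<otimes> h [^] j') \<otimes> h [^] (-j')"
    by (simp add: eq)
  also have "\<dots> = h [^] (i - i') \<otimes> n"
    using n by (simp add: m_assoc int_pow_mult[symmetric]) (simp add: int_pow_mult[symmetric] m_assoc[symmetric])
  finally show ?thesis .
qed

lemma near_orbit:
  assumes "near_proj A x a"
  shows "\<exists>k::int. dist x (\<phi> (h [^] k) p) \<le> dist x a + R"
proof -
  obtain k :: int where "dist a (\<phi> (h [^] k) p) \<le> R"
    using near_projD(1)[OF assms] orbit_coarsely_dense by blast
  then show ?thesis
    using dist_triangle[of x "\<phi> (h [^] k) p" a] by (intro exI[of _ k]) linarith
qed

text \<open>
  If the projection of \<open>n A\<close> to \<open>A\<close> were long, the two axes would fellow travel, and the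
  pigeonhole principle applied to the elements \<open>h\<^sup>-\<^sup>i n h\<^sup>j\<close> of bounded displacement would make
  \<open>n\<close> commensurate the cyclic group of \<open>h\<close>.
\<close>

lemma bounded_projection:
  assumes n: "n \<in> carrier G" and "\<not> commensurates n"
  shows "\<exists>M. projection_bound A (\<phi> n ` A) M"
proof -
  \<comment> \<open>\<open>2 * C + 1\<close> will bound the distance from sample points to either
    axis, and \<open>R\<close> leads on to an orbit point.\<close>
  define \<rho> where "\<rho> = 2 * C + 1 + R"
  define F where "F = {g \<in> carrier G. dist (\<phi> g p) p \<le> 2 * \<rho>}"
  have "finite F"
    unfolding F_def by (rule finite_near_translates)
  \<comment> \<open>Samples spaced by more than \<open>2 * \<rho>\<close> cannot both be
    \<open>\<rho>\<close>-close to the same orbit point.\<close>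
  define \<sigma> where "\<sigma> = 2 * \<rho> + 1"
  have \<sigma>: "\<sigma> > 0" "\<rho> > 0"
    using C_nonneg R_nonneg by (auto simp: \<sigma>_def \<rho>_def)
  define M where "M = 2 * C + real (card F) * \<sigma>"
  have "dist a b \<le> M"
    if xy: "x \<in> \<phi> n ` A" "y \<in> \<phi> n ` A" and ab: "near_proj A x a" "near_proj A y b" for x y a b
  proof (rule ccontr)
    assume "\<not> dist a b \<le> M"
    then have big: "dist a b > 2 * C + real (card F) * \<sigma>"
      by (simp add: M_def)
    have nF: "real (card F) * \<sigma> \<ge> 0"
      using \<sigma> by simp
    have "dist x a + dist a b + dist b y \<le> dist x y + C"
      using bottleneck_A ab big nF C_nonneg by (intro bottleneckD) auto
    then have long: "dist x a + real (card F) * \<sigma> \<le> dist x y - dist b y"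
      using big C_nonneg by linarith
    obtain \<gamma> where \<gamma>: "\<gamma> 0 = x" "\<gamma> (dist x y) = y" "geodesic_on {0..dist x y} \<gamma>"
      using geodesic_on_ex[of x y] by blast
    have D: "dist (\<gamma> s) (\<gamma> t) = \<bar>s - t\<bar>" if "s \<in> {0..dist x y}" "t \<in> {0..dist x y}" for s t
      using \<gamma> that by (simp add: geodesic_on_def)
    \<comment> \<open>The times \<open>u 0\<close> to \<open>u (card F)\<close> lie between the
      passages near \<open>a\<close> and \<open>b\<close>; there is one sample more than
      \<open>F\<close> has elements.\<close>
    define u where "u t = dist x a + real t * \<sigma>" for t :: nat
    define z where "z t = \<gamma> (u t)" for t
    have u: "u t \<in> {0..dist x y}" "dist x a \<le> u t" "u t \<le> dist x y - dist b y" if "t \<le> card F" for t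
    proof -
      have "real t * \<sigma> \<le> real (card F) * \<sigma>" "0 \<le> real t * \<sigma>"
        using that \<sigma> by auto
      then show "u t \<in> {0..dist x y}" "dist x a \<le> u t" "u t \<le> dist x y - dist b y"
        using long zero_le_dist[of x a] zero_le_dist[of b y] unfolding u_def atLeastAtMost_iff by linarith+
    qed
    have "\<exists>(i::int) (j::int). dist (z t) (\<phi> (h [^] i) p) \<le> \<rho> \<and> dist (z t) (\<phi> n (\<phi> (h [^] j) p)) \<le> \<rho>"
      if t: "t \<le> card F" for t
    proof -
      have xz: "dist x (z t) = u t"
        using D[of 0 "u t"] u[OF t] \<gamma> by (simp add: z_def)
      have zy: "dist (z t) y = dist x y - u t"
        using D[of "u t" "dist x y"] u[OF t] \<gamma> by (simp add: z_def)
      obtain c where c: "near_proj A (z t) c"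
        using near_proj_exists[OF A_nonempty] by blast
      have zc: "dist (z t) c \<le> 2 * C"
        using u[OF t] xz zy big nF
        by (intro bottleneck_between[OF bottleneck_A C_nonneg ab c]) auto
      obtain i :: int where "dist (z t) (\<phi> (h [^] i) p) \<le> dist (z t) c + R"
        using near_orbit[OF c] by blast
      then have i: "dist (z t) (\<phi> (h [^] i) p) \<le> \<rho>"
        using zc unfolding \<rho>_def by linarith
      obtain w where w: "near_proj (\<phi> n ` A) (z t) w"
        using near_proj_exists[of "\<phi> n ` A" "z t"] A_nonempty by auto
      have zw: "dist (z t) w \<le> 2 * C + 1"
        using xz zy n by (intro bottleneck_quasiconvex[OF bottleneck_act[OF n bottleneck_A] C_nonneg xy w]) auto
      have "near_proj A (\<phi> (inv n) (z t)) (\<phi> (inv n) w)"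
        using w n by (simp add: near_proj_act_iff)
      then obtain j :: int where "dist (\<phi> (inv n) (z t)) (\<phi> (h [^] j) p) \<le> dist (\<phi> (inv n) (z t)) (\<phi> (inv n) w) + R"
        using near_orbit by blast
      moreover have "dist (\<phi> (inv n) (z t)) (\<phi> (h [^] j) p) = dist (z t) (\<phi> n (\<phi> (h [^] j) p))"
        using n isometric[of n "\<phi> (inv n) (z t)"] by simp
      moreover have "dist (\<phi> (inv n) (z t)) (\<phi> (inv n) w) = dist (z t) w"
        using n by (simp add: isometric)
      ultimately have "dist (z t) (\<phi> n (\<phi> (h [^] j) p)) \<le> \<rho>"
        using zw unfolding \<rho>_def by linarith
      then show ?thesis using i by blast
    qed
    then obtain i j :: "nat \<Rightarrow> int" where
      i: "\<And>t. t \<le> card F \<Longrightarrow> dist (z t) (\<phi> (h [^] i t) p) \<le> \<rho>" and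
      j: "\<And>t. t \<le> card F \<Longrightarrow> dist (z t) (\<phi> n (\<phi> (h [^] j t) p)) \<le> \<rho>"
      by meson
    \<comment> \<open>The sample \<open>z t\<close> is close to both orbit points, so
      \<open>f t\<close> displaces \<open>p\<close> by at most \<open>2 * \<rho>\<close>.\<close>
    define f where "f t = h [^] (- i t) \<otimes> n \<otimes> h [^] j t" for t
    have "f t \<in> F" if t: "t \<le> card F" for t
    proof -
      have "dist (\<phi> (f t) p) p = dist (\<phi> (h [^] i t) (\<phi> (f t) p)) (\<phi> (h [^] i t) p)"
        by (simp add: isometric)
      also have "\<phi> (h [^] i t) (\<phi> (f t) p) = \<phi> n (\<phi> (h [^] j t) p)"
        using n act_pow_add[of h "i t" "- i t"] by (simp add: f_def act_mult m_assoc)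
      also have "dist (\<phi> n (\<phi> (h [^] j t) p)) (\<phi> (h [^] i t) p) \<le> 2 * \<rho>"
        using i[OF t] j[OF t] dist_triangle3[of "\<phi> n (\<phi> (h [^] j t) p)" "\<phi> (h [^] i t) p" "z t"] by linarith
      finally show ?thesis
        using n by (simp add: F_def f_def)
    qed
    then have "f ` {..card F} \<subseteq> F" by auto
    then have "card (f ` {..card F}) < card {..card F}"
      using card_mono[OF \<open>finite F\<close>, of "f ` {..card F}"] by simp
    then have "\<not> inj_on f {..card F}"
      by (rule pigeonhole)
    then obtain s t where st: "s \<le> card F" "t \<le> card F" "s \<noteq> t" "f s = f t"
      unfolding inj_on_def atMost_iff by blast
    have "u s - u t = (real s - real t) * \<sigma>"
      by (simp add: u_def algebra_simps)
    then have us: "\<bar>u s - u t\<bar> = \<bar>real s - real t\<bar> * \<sigma>"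
      using \<sigma> by (simp add: abs_mult)
    have "\<bar>real s - real t\<bar> \<ge> 1"
      using st(3) by linarith
    then have "\<sigma> \<le> \<bar>real s - real t\<bar> * \<sigma>"
      using \<sigma> by simp
    also have "\<dots> = \<bar>u s - u t\<bar>"
      by (simp add: us)
    also have "\<dots> = dist (z s) (z t)"
      unfolding z_def using D u st by simp
    finally have apart: "dist (z s) (z t) > 2 * \<rho>"
      by (simp add: \<sigma>_def)
    have "i s \<noteq> i t"
    proof
      assume "i s = i t"
      then show False
        using apart i[OF st(1)] i[OF st(2)] dist_triangle2[of "z s" "z t" "\<phi> (h [^] i s) p"] by simp
    qed
    moreover have "j s \<noteq> j t"
    proof
      assume "j s = j t"
      then show False
        using apart j[OF st(1)] j[OF st(2)] dist_triangle2[of "z s" "z t" "\<phi> n (\<phi> (h [^] j s) p)"] by simp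
    qed
    moreover have "n \<otimes> h [^] (j s - j t) = h [^] (i s - i t) \<otimes> n"
      using st(4) n by (intro coset_eq_conj) (simp_all add: f_def)
    ultimately have "commensurates n"
      unfolding commensurates_def
      by (intro exI[of _ "j s - j t"] exI[of _ "i s - i t"]) simp
    then show False
      using \<open>\<not> commensurates n\<close> by simp
  qed
  then have "projection_bound A (\<phi> n ` A) M"
    by (simp add: projection_bound_def)
  then show ?thesis ..
qed

text \<open>Projecting \<open>A\<close> to \<open>n A\<close> is the translate by \<open>n\<close>
  of projecting the translate of \<open>A\<close> by \<open>inv n\<close> to
  \<open>A\<close>.\<close>

lemma bounded_projections:
  assumes n: "n \<in> carrier G" and nc: "\<not> commensurates n"
  shows "\<exists>M. projection_bound A (\<phi> n ` A) M \<and> projection_bound (\<phi> n ` A) A M"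
proof -
  obtain M1 where M1: "projection_bound A (\<phi> n ` A) M1"
    using bounded_projection[OF n nc] by blast
  have "\<not> commensurates (inv n)"
    using commensurates_inv n nc by blast
  then obtain M2 where M2: "projection_bound A (\<phi> (inv n) ` A) M2"
    using bounded_projection[of "inv n"] n by blast
  have "dist a b \<le> M2"
    if "x \<in> A" "y \<in> A" "near_proj (\<phi> n ` A) x a" "near_proj (\<phi> n ` A) y b" for x y a b
  proof -
    have "dist (\<phi> (inv n) a) (\<phi> (inv n) b) \<le> M2"
      using that n by (intro projection_boundD[OF M2, of "\<phi> (inv n) x" "\<phi> (inv n) y"]) (auto simp: near_proj_act_iff)
    then show ?thesis
      using n by (simp add: isometric)
  qed
  then have "projection_bound (\<phi> n ` A) A M2"
    by (simp add: projection_bound_def)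
  then show ?thesis
    using projection_bound_mono[OF M1 max.cobounded1, of M2]
      projection_bound_mono[OF _ max.cobounded2, of "\<phi> n ` A" A M2 M1] by blast
qed

text \<open>
  With \<open>k = n h\<^sup>m n\<^sup>-\<^sup>1\<close> and \<open>g = k h\<^sup>-\<^sup>m\<close>, consecutive members of the chain
  \<open>A, n A, g A = k A, g n A, \<dots>\<close> have bounded projections to each other, while the two neighbours of
  a member project far apart once \<open>m\<close> is large. The half-space \<open>U\<close> consists of the points whose
  projection to \<open>A\<close> is far from that of \<open>n A\<close>.
\<close>

lemma commutator_strongly_contracting:
  assumes n: "n \<in> carrier G" and nc: "\<not> commensurates n"
  shows "\<exists>m::int. strongly_contracting_element G \<phi> p (n \<otimes> h [^] m \<otimes> inv n \<otimes> h [^] (-m))"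
proof -
  let ?B = "\<phi> n ` A"
  obtain M where MA: "projection_bound A ?B M" and MB: "projection_bound ?B A M"
    using bounded_projections[OF n nc] by blast
  note bnB = bottleneck_act[OF n bottleneck_A]
  obtain a0 where a0: "a0 \<in> A" using A_nonempty by blast
  define b0 where "b0 = \<phi> n a0"
  have b0: "b0 \<in> ?B" using a0 by (simp add: b0_def)
  obtain \<alpha> where \<alpha>: "near_proj A b0 \<alpha>" using near_proj_exists[OF A_nonempty] by blast
  obtain \<beta> where \<beta>: "near_proj ?B a0 \<beta>" using near_proj_exists[of ?B] A_nonempty by blast
  have "M \<ge> 0" using projection_boundD[OF MA b0 b0 \<alpha> \<alpha>] by simp
  define \<theta> where "\<theta> = 2 * C + M"
  have \<theta>: "\<theta> \<ge> 0" "C \<le> \<theta>" "M \<le> \<theta>"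
    using C_nonneg \<open>M \<ge> 0\<close> by (auto simp: \<theta>_def)
  have behrstock: "dist a \<alpha> \<le> \<theta> \<or> dist b \<beta> \<le> \<theta>" if "near_proj A x a" "near_proj ?B x b" for x a b
    unfolding \<theta>_def by (rule behrstock_inequality[OF bottleneck_A bnB C_nonneg MA MB that b0 \<alpha> a0 \<beta>])
  \<comment> \<open>The power must make the \<open>\<theta>\<close>-balls around
    \<open>\<alpha>\<close> and its translate disjoint, and likewise for \<open>\<beta>\<close>
    under \<open>k\<close>, there with a spare \<open>C\<close> to trigger the bottleneck of
    \<open>?B\<close>.\<close>
  obtain m1 where m1: "\<And>m::int. m1 \<le> \<bar>m\<bar> \<Longrightarrow> 2 * \<theta> < dist (\<phi> (h [^] m) \<alpha>) \<alpha>"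
    using pow_escapes[where x = \<alpha> and y = \<alpha>] by blast
  obtain m2 where m2: "\<And>m::int. m2 \<le> \<bar>m\<bar> \<Longrightarrow>
      2 * \<theta> + C < dist (\<phi> (h [^] m) (\<phi> (inv n) \<beta>)) (\<phi> (inv n) \<beta>)"
    using pow_escapes[where x = "\<phi> (inv n) \<beta>" and y = "\<phi> (inv n) \<beta>"] by blast
  define m where "m = max m1 m2"
  define k where "k = n \<otimes> h [^] m \<otimes> inv n"
  define g where "g = k \<otimes> h [^] (-m)"
  have k: "k \<in> carrier G" and g: "g \<in> carrier G"
    using n by (simp_all add: k_def g_def)
  have m_\<alpha>: "2 * \<theta> < dist (\<phi> (h [^] (-m)) \<alpha>) \<alpha>"
    by (rule m1) (simp add: m_def)
  have "dist (\<phi> k \<beta>) \<beta> = dist (\<phi> (h [^] m) (\<phi> (inv n) \<beta>)) (\<phi> (inv n) \<beta>)"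
    using n isometric[of n "\<phi> (h [^] m) (\<phi> (inv n) \<beta>)" "\<phi> (inv n) \<beta>"] by (simp add: k_def act_mult)
  then have m_\<beta>: "2 * \<theta> + C < dist (\<phi> k \<beta>) \<beta>"
    using m2[of m] by (simp add: m_def)
  have kinv: "\<phi> (inv k) x \<in> ?B" if "x \<in> ?B" for x
  proof -
    have "\<phi> (inv k) x = \<phi> n (\<phi> (h [^] (-m)) (\<phi> (inv n) x))"
      using n by (simp add: k_def inv_mult_group act_mult int_pow_neg)
    then show ?thesis
      using that n pow_in_A by (auto simp: act_image_iff)
  qed
  have k_B: "\<phi> k ` ?B = ?B"
  proof
    show "?B \<subseteq> \<phi> k ` ?B"
      using kinv k by (auto simp: act_image_iff)
    show "\<phi> k ` ?B \<subseteq> ?B"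
      using n pow_in_A by (auto simp: k_def act_mult)
  qed
  define U where "U = {x. \<exists>a. near_proj A x a \<and> dist a \<alpha> > \<theta>}"
  have in_U: "dist b \<beta> \<le> \<theta>" if "x \<in> U" "near_proj ?B x b" for x b
    using that behrstock unfolding U_def by fastforce
  \<comment> \<open>As \<open>g = k \<otimes> h [^] (-m)\<close>, pulling \<open>y\<close> back by
    \<open>k\<close> gives a point projecting to \<open>A\<close> near the translate of
    \<open>\<alpha>\<close>, hence far from \<open>\<alpha>\<close>. That point lies in
    \<open>U\<close>, and Behrstock's inequality locates its projection to
    \<open>?B\<close>.\<close>
  have notin_gU: "dist (\<phi> (inv k) b) \<beta> \<le> \<theta> \<and> dist a (\<phi> (h [^] (-m)) \<alpha>) \<le> \<theta>"
    if y: "y \<notin> \<phi> g ` U" and a: "near_proj A (\<phi> (inv k) y) a" and b: "near_proj ?B y b" for y a b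
  proof
    have "inv g = h [^] m \<otimes> inv k"
      using k by (simp add: g_def inv_mult_group int_pow_neg)
    then have "\<phi> (h [^] m) (\<phi> (inv k) y) \<notin> U"
      using y g k by (simp add: act_image_iff act_mult)
    moreover have "near_proj A (\<phi> (h [^] m) (\<phi> (inv k) y)) (\<phi> (h [^] m) a)"
      using a by (simp add: near_proj_pow)
    ultimately have "dist (\<phi> (h [^] m) a) \<alpha> \<le> \<theta>"
      unfolding U_def mem_Collect_eq not_ex de_Morgan_conj not_less by blast
    moreover have "dist (\<phi> (h [^] m) a) \<alpha> = dist a (\<phi> (h [^] (-m)) \<alpha>)"
      using isometric[of "h [^] m" a "\<phi> (h [^] (-m)) \<alpha>"] by (simp add: int_pow_neg)
    ultimately show am: "dist a (\<phi> (h [^] (-m)) \<alpha>) \<le> \<theta>"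
      by simp
    have kb: "near_proj ?B (\<phi> (inv k) y) (\<phi> (inv k) b)"
      using b near_proj_act_iff[OF k, of ?B y b] unfolding k_B by blast
    have "dist a \<alpha> > \<theta>"
      using am m_\<alpha> dist_triangle3[of "\<phi> (h [^] (-m)) \<alpha>" \<alpha> a] by linarith
    then have "\<phi> (inv k) y \<in> U"
      using a by (auto simp: U_def)
    then show "dist (\<phi> (inv k) b) \<beta> \<le> \<theta>"
      using kb by (rule in_U)
  qed
  have ex: "\<exists>a b. near_proj A (\<phi> (inv k) y) a \<and> near_proj ?B y b" for y
    using near_proj_exists[OF A_nonempty, of "\<phi> (inv k) y"] near_proj_exists[of ?B y] A_nonempty by simp
  have kb: "dist b (\<phi> k \<beta>) \<le> \<theta>" if "y \<notin> \<phi> g ` U" "near_proj ?B y b" for y b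
  proof -
    obtain a where "near_proj A (\<phi> (inv k) y) a"
      using near_proj_exists[OF A_nonempty] by blast
    then have "dist (\<phi> (inv k) b) \<beta> \<le> \<theta>"
      using notin_gU[OF that(1) _ that(2)] by simp
    then show ?thesis
      using isometric[of k "\<phi> (inv k) b" \<beta>] k by simp
  qed
  \<comment> \<open>\<open>C\<close> is the bottleneck error of \<open>?B\<close>,
    \<open>2 * \<theta>\<close> pays for routing through \<open>\<beta>\<close>, and the last term
    for replacing \<open>\<beta>\<close> by \<open>p\<close>.\<close>
  interpret separating_translate G \<phi> g U p b0 "C + 2 * \<theta> + 2 * dist \<beta> p"
  proof
    show "g \<in> carrier G" by (rule g)
    show "U \<subseteq> \<phi> g ` U"
    proof (rule subsetI, rule ccontr)
      \<comment> \<open>Such a point would project to \<open>?B\<close> near both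
        \<open>\<beta>\<close> and \<open>\<phi> k \<beta>\<close>.\<close>
      fix x assume x: "x \<in> U" "x \<notin> \<phi> g ` U"
      obtain b where b: "near_proj ?B x b" using ex by blast
      show False
        using in_U[OF x(1) b] kb[OF x(2) b] m_\<beta> C_nonneg dist_triangle3[of "\<phi> k \<beta>" \<beta> b] by linarith
    qed
    show "b0 \<in> \<phi> g ` U"
    proof (rule ccontr)
      assume b0U: "b0 \<notin> \<phi> g ` U"
      obtain a b where ab: "near_proj A (\<phi> (inv k) b0) a" "near_proj ?B b0 b" using ex by blast
      \<comment> \<open>Pulling \<open>b0\<close> back by \<open>k\<close> stays in
        \<open>?B\<close>, whose projection to \<open>A\<close> is near \<open>\<alpha>\<close> and
        so far from where \<open>notin_gU\<close> puts it.\<close>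
      have "dist a \<alpha> \<le> M"
        using projection_boundD[OF MA kinv[OF b0] b0 ab(1) \<alpha>] .
      then show False
        using notin_gU[OF b0U ab] m_\<alpha> \<theta> dist_triangle3[of "\<phi> (h [^] (-m)) \<alpha>" \<alpha> a] by linarith
    qed
    show "b0 \<notin> U"
      using bottleneck_near_unique[OF bottleneck_A _ \<alpha>] \<theta> by (fastforce simp: U_def)
    show "dist x p + dist p y \<le> dist x y + (C + 2 * \<theta> + 2 * dist \<beta> p)" if x: "x \<in> U" and y: "y \<notin> \<phi> g ` U" for x y
    proof -
      obtain b where b: "near_proj ?B x b" using ex by blast
      obtain b' where b': "near_proj ?B y b'" using ex by blast
      have 1: "dist b \<beta> \<le> \<theta>" "dist b' (\<phi> k \<beta>) \<le> \<theta>"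
        using in_U[OF x b] kb[OF y b'] by auto
      have "dist \<beta> (\<phi> k \<beta>) \<le> dist b \<beta> + dist b b' + dist b' (\<phi> k \<beta>)"
        using dist_triangle3[of \<beta> "\<phi> k \<beta>" b] dist_triangle[of b "\<phi> k \<beta>" b'] by linarith
      then have "dist b b' > C"
        using 1 m_\<beta> dist_commute[of \<beta> "\<phi> k \<beta>"] by linarith
      then have "dist x b + dist b b' + dist b' y \<le> dist x y + C"
        by (rule bottleneckD[OF bnB b b'])
      then show ?thesis
        using 1 dist_triangle[of x p \<beta>] dist_triangle3[of p y \<beta>]
          dist_triangle[of x \<beta> b] dist_triangle3[of \<beta> y b] dist_triangle[of b y b'] by linarith
    qed
  qed
  show ?thesis
    using strongly_contracting unfolding g_def k_def by blast
qed

text \<open>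
  \<open>n p\<close> and its projection to \<open>A\<close> are displaced by \<open>h\<^sup>s\<close> by the same amount up to \<open>2 R\<close>, whereas the
  bottleneck property makes the former displacement larger by twice the distance to \<open>A\<close>. What
  matters is that the bound does not depend on \<open>n\<close>.
\<close>

lemma commuting_translate_near_axis:
  assumes n: "n \<in> carrier G" and "i \<noteq> 0" and comm: "n \<otimes> h [^] (i::int) = h [^] i \<otimes> n"
    and w: "near_proj A (\<phi> n p) w"
  shows "2 * dist (\<phi> n p) w \<le> C + 2 * R"
proof -
  obtain k0 where k0: "\<And>k::int. k0 \<le> \<bar>k\<bar> \<Longrightarrow> C + 2 * R < dist (\<phi> (h [^] k) p) p"
    using orbit_escapes by blast
  \<comment> \<open>A multiple of \<open>i\<close>, so that \<open>h [^] s\<close> commutes with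
    \<open>n\<close>, of absolute value at least \<open>k0\<close>; \<open>nat\<close> covers
    negative \<open>k0\<close>.\<close>
  define s where "s = i * int (nat k0)"
  have "k0 \<le> \<bar>s\<bar>"
  proof -
    have "k0 \<le> 1 * int (nat k0)" by simp
    also have "\<dots> \<le> \<bar>i\<bar> * int (nat k0)"
      using \<open>i \<noteq> 0\<close> by (intro mult_right_mono) auto
    finally show ?thesis by (simp add: s_def abs_mult)
  qed
  then have big: "C + 2 * R < dist (\<phi> (h [^] s) p) p"
    by (rule k0)
  have "h [^] s = (h [^] i) [^] nat k0"
    by (simp add: s_def int_pow_pow[symmetric] int_pow_int)
  then have "n \<otimes> h [^] s = h [^] s \<otimes> n"
    using group_commutes_pow[of "h [^] i" n "nat k0"] n comm by simp
  then have "\<phi> (h [^] s) (\<phi> n p) = \<phi> n (\<phi> (h [^] s) p)"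
    using n by (metis act_mult h_in int_pow_closed)
  then have np: "dist (\<phi> (h [^] s) (\<phi> n p)) (\<phi> n p) = dist (\<phi> (h [^] s) p) p"
    using n by (simp add: isometric)
  obtain j :: int where j: "dist w (\<phi> (h [^] j) p) \<le> R"
    using orbit_coarsely_dense near_projD(1)[OF w] by blast
  have "\<phi> (h [^] s) (\<phi> (h [^] j) p) = \<phi> (h [^] j) (\<phi> (h [^] s) p)"
    using act_pow_add[of h s j p] act_pow_add[of h j s p] by (simp add: add.commute)
  then have "dist (\<phi> (h [^] s) p) p = dist (\<phi> (h [^] s) (\<phi> (h [^] j) p)) (\<phi> (h [^] j) p)"
    by (simp add: isometric)
  also have "\<dots> \<le> dist (\<phi> (h [^] s) (\<phi> (h [^] j) p)) (\<phi> (h [^] s) w) + dist (\<phi> (h [^] s) w) w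
      + dist w (\<phi> (h [^] j) p)"
    using dist_triangle[of "\<phi> (h [^] s) (\<phi> (h [^] j) p)" "\<phi> (h [^] j) p" "\<phi> (h [^] s) w"]
      dist_triangle[of "\<phi> (h [^] s) w" "\<phi> (h [^] j) p" w] by linarith
  also have "dist (\<phi> (h [^] s) (\<phi> (h [^] j) p)) (\<phi> (h [^] s) w) = dist w (\<phi> (h [^] j) p)"
    by (simp add: isometric dist_commute)
  finally have wp: "dist (\<phi> (h [^] s) p) p \<le> dist (\<phi> (h [^] s) w) w + 2 * R"
    using j by linarith
  \<comment> \<open>\<open>big\<close> and \<open>wp\<close> put \<open>w\<close> and its translate
    more than \<open>C\<close> apart.\<close>
  have "dist (\<phi> n p) w + dist w (\<phi> (h [^] s) w) + dist (\<phi> (h [^] s) w) (\<phi> (h [^] s) (\<phi> n p))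
      \<le> dist (\<phi> n p) (\<phi> (h [^] s) (\<phi> n p)) + C"
    using wp big w by (intro bottleneckD[OF bottleneck_A]) (auto simp: near_proj_pow dist_commute)
  moreover have "dist (\<phi> (h [^] s) w) (\<phi> (h [^] s) (\<phi> n p)) = dist (\<phi> n p) w"
    by (simp add: isometric dist_commute)
  ultimately show ?thesis
    using np wp dist_commute[of w "\<phi> (h [^] s) w"] dist_commute[of "\<phi> n p" "\<phi> (h [^] s) (\<phi> n p)"]
    by linarith
qed

text \<open>For unequal exponents, the commutator of \<open>n\<close> and \<open>h [^] i\<close> is
  \<open>h [^] (j - i)\<close> and lies in \<open>N\<close> by normality. Otherwise each
  \<open>n\<close> in \<open>N\<close> can be moved back by a power of \<open>h\<close> to bounded
  displacement; two distinct elements then give the same result, and their quotient is a power of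
  \<open>h\<close>.\<close>

lemma normal_contains_power:
  assumes "N \<lhd> G" and "infinite N" and comm: "\<And>n. n \<in> N \<Longrightarrow> commensurates n"
  shows "\<exists>k::int. k \<noteq> 0 \<and> h [^] k \<in> N"
proof -
  interpret N: normal N G by fact
  have N_in: "n \<in> carrier G" if "n \<in> N" for n
    using N.subset that by blast
  show ?thesis
  proof (cases "\<exists>n\<in>N. \<exists>(i::int) (j::int). i \<noteq> j \<and> n \<otimes> h [^] i = h [^] j \<otimes> n")
    case True
    then obtain n and i j :: int where n: "n \<in> N" "i \<noteq> j" "n \<otimes> h [^] i = h [^] j \<otimes> n" by blast
    have nG: "n \<in> carrier G" using n N_in by blast
    have "h [^] i \<otimes> inv n \<otimes> inv (h [^] i) \<in> N"
      using n(1) by (intro N.inv_op_closed2) auto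
    then have "n \<otimes> (h [^] i \<otimes> inv n \<otimes> inv (h [^] i)) \<in> N"
      using n(1) by blast
    also have "n \<otimes> (h [^] i \<otimes> inv n \<otimes> inv (h [^] i)) = (n \<otimes> h [^] i) \<otimes> inv n \<otimes> inv (h [^] i)"
      using nG by (simp add: m_assoc)
    also have "\<dots> = h [^] j \<otimes> inv (h [^] i)"
      using nG by (simp add: n(3) m_assoc)
    also have "\<dots> = h [^] (j - i)"
      by (simp add: int_pow_diff)
    finally show ?thesis
      using n(2) by (intro exI[of _ "j - i"]) simp
  next
    case False
    have "\<exists>k::int. 2 * dist (\<phi> n p) (\<phi> (h [^] k) p) \<le> C + 4 * R" if n: "n \<in> N" for n
    proof -
      obtain i :: int where i: "i \<noteq> 0" "n \<otimes> h [^] i = h [^] i \<otimes> n"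
        using comm[OF n] False n unfolding commensurates_def by metis
      obtain w where w: "near_proj A (\<phi> n p) w"
        using near_proj_exists[OF A_nonempty] by blast
      obtain k :: int where "dist (\<phi> n p) (\<phi> (h [^] k) p) \<le> dist (\<phi> n p) w + R"
        using near_orbit[OF w] by blast
      then show ?thesis
        using commuting_translate_near_axis[OF N_in[OF n] i w] by (intro exI[of _ k]) linarith
    qed
    then obtain k :: "'g \<Rightarrow> int" where k: "\<And>n. n \<in> N \<Longrightarrow> 2 * dist (\<phi> n p) (\<phi> (h [^] k n) p) \<le> C + 4 * R"
      by metis
    define f where "f n = h [^] (- k n) \<otimes> n" for n
    have "f ` N \<subseteq> {g \<in> carrier G. dist (\<phi> g p) p \<le> (C + 4 * R) / 2}"
    proof safe
      fix n assume n: "n \<in> N"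
      then show "f n \<in> carrier G" using N_in by (simp add: f_def)
      have "dist (\<phi> (f n) p) p = dist (\<phi> (h [^] k n) (\<phi> (f n) p)) (\<phi> (h [^] k n) p)"
        by (simp add: isometric)
      also have "\<phi> (h [^] k n) (\<phi> (f n) p) = \<phi> n p"
        using N_in[OF n] act_pow_add[of h "k n" "- k n"] by (simp add: f_def act_mult)
      finally show "dist (\<phi> (f n) p) p \<le> (C + 4 * R) / 2"
        using k[OF n] by simp
    qed
    then have "finite (f ` N)"
      using finite_near_translates finite_subset by blast
    then obtain n where n: "n \<in> N" "infinite {n' \<in> N. f n' = f n}"
      using pigeonhole_infinite[OF \<open>infinite N\<close>] by blast
    then have "{n' \<in> N. f n' = f n} \<noteq> {n}" "{n' \<in> N. f n' = f n} \<noteq> {}"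
      by (metis finite.emptyI finite.insertI) (use n in auto)
    then obtain n' where n': "n' \<in> N" "f n' = f n" "n' \<noteq> n"
      using n by blast
    have "n' \<otimes> inv n = h [^] (k n' - k n)"
    proof -
      have "n' = h [^] k n' \<otimes> f n'"
        using N_in[OF n'(1)] by (simp add: f_def int_pow_neg flip: m_assoc)
      also have "\<dots> = h [^] k n' \<otimes> h [^] (- k n) \<otimes> n"
        using N_in[OF n(1)] by (simp add: n'(2)) (simp add: f_def m_assoc)
      finally have "n' = h [^] (k n' - k n) \<otimes> n"
        by (simp flip: int_pow_mult)
      then show ?thesis
        using N_in[OF n(1)] by (metis h_in int_pow_closed inv_solve_right m_closed)
    qed
    moreover have "n' \<otimes> inv n \<in> N"
      using n n' by blast
    moreover have "k n' \<noteq> k n"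
    proof
      assume "k n' = k n"
      then have "h [^] (- k n) \<otimes> n' = h [^] (- k n) \<otimes> n"
        using n'(2) by (simp add: f_def)
      then show False
        using n'(3) N_in[OF n(1)] N_in[OF n'(1)] by simp
    qed
    ultimately show ?thesis
      by (intro exI[of _ "k n' - k n"]) simp
  qed
qed

end

section \<open>Normal subgroups\<close>

lemma (in G_space) continuous_act:
  assumes "g \<in> carrier G"
  shows "continuous_on S (\<phi> g)"
  unfolding continuous_on_iff using assms by (auto simp: isometric)

text \<open>The same \<open>A\<close> and \<open>\<pi>\<close> serve. The subgroup of
  \<open>h [^] k\<close> has finite index in that of \<open>h\<close>, so finitely many translates
  of \<open>K\<close> replace \<open>K\<close>, and \<open>L\<close> grows by the factor
  \<open>\<bar>k\<bar>\<close>.\<close>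

lemma (in G_space) strongly_contracting_element_pow:
  assumes sc: "strongly_contracting_element G \<phi> p h" and "k \<noteq> (0::int)"
  shows "strongly_contracting_element G \<phi> p (h [^]\<^bsub>G\<^esub> k)"
proof -
  have h: "h \<in> carrier G"
    using sc by (simp add: strongly_contracting_element_def)
  obtain L B where LB: "L \<ge> 1" "B \<ge> 0" and
      q: "\<And>i j::int. \<bar>real_of_int (i - j)\<bar> / L - B \<le> dist (\<phi> (h [^]\<^bsub>G\<^esub> i) p) (\<phi> (h [^]\<^bsub>G\<^esub> j) p) \<and>
        dist (\<phi> (h [^]\<^bsub>G\<^esub> i) p) (\<phi> (h [^]\<^bsub>G\<^esub> j) p) \<le> L * \<bar>real_of_int (i - j)\<bar> + B"
    using sc unfolding strongly_contracting_element_def quasi_geodesic_def by blast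
  obtain A \<pi> where A: "acts_cocompactly_on \<phi> (generate G {h}) A" "strongly_contracting_map A \<pi>"
    using sc unfolding strongly_contracting_element_def by blast
  obtain K where K: "compact K" "K \<subseteq> A" "(\<Union>g\<in>generate G {h}. \<phi> g ` K) = A"
    using A(1) unfolding acts_cocompactly_on_def by blast
  have gen: "generate G {g} = range (\<lambda>i::int. g [^]\<^bsub>G\<^esub> i)" if "g \<in> carrier G" for g
    using generate_pow[OF that] by auto
  have pow: "\<phi> (h [^]\<^bsub>G\<^esub> i) a \<in> A" if a: "a \<in> A" for a and i :: int
  proof -
    have "a \<in> (\<Union>g\<in>generate G {h}. \<phi> g ` K)" using a K(3) by simp
    then obtain j :: int and x where "a = \<phi> (h [^]\<^bsub>G\<^esub> j) x" "x \<in> K"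
      using gen[OF h] by auto
    then have "\<phi> (h [^]\<^bsub>G\<^esub> i) a \<in> \<phi> (h [^]\<^bsub>G\<^esub> (i + j)) ` K"
      using act_pow_add[OF h, of i j x] by (metis imageI)
    then show ?thesis
      using K(3) gen[OF h] by blast
  qed
  have kk: "(h [^]\<^bsub>G\<^esub> k) [^]\<^bsub>G\<^esub> i = h [^]\<^bsub>G\<^esub> (k * i)" for i :: int
    using h by (simp add: int_pow_pow)
  define K' where "K' = (\<Union>j\<in>{0..<\<bar>k\<bar>}. \<phi> (h [^]\<^bsub>G\<^esub> j) ` K)"
  have "compact K'"
    unfolding K'_def using K(1) h
    by (intro compact_UN compact_continuous_image continuous_act) auto
  moreover have "K' \<subseteq> A"
    unfolding K'_def using pow K(2) by blast
  moreover have "(\<Union>g\<in>generate G {h [^]\<^bsub>G\<^esub> k}. \<phi> g ` K') = A"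
  proof
    show "(\<Union>g\<in>generate G {h [^]\<^bsub>G\<^esub> k}. \<phi> g ` K') \<subseteq> A"
      using gen[of "h [^]\<^bsub>G\<^esub> k"] h \<open>K' \<subseteq> A\<close> pow by (auto simp: kk)
    show "A \<subseteq> (\<Union>g\<in>generate G {h [^]\<^bsub>G\<^esub> k}. \<phi> g ` K')"
    proof
      fix a assume "a \<in> A"
      then have "a \<in> (\<Union>g\<in>generate G {h}. \<phi> g ` K)" using K(3) by simp
      then obtain i :: int and x where x: "a = \<phi> (h [^]\<^bsub>G\<^esub> i) x" "x \<in> K"
        using gen[OF h] by auto
      define r where "r = i mod \<bar>k\<bar>"
      \<comment> \<open>The sign makes \<open>k * s\<close> equal to
        \<open>\<bar>k\<bar> * (i div \<bar>k\<bar>)\<close>, so the remainder stays in the range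
        used for \<open>K'\<close>.\<close>
      define s where "s = sgn k * (i div \<bar>k\<bar>)"
      have "i = k * s + r"
        by (simp add: r_def s_def abs_sgn mult.assoc[symmetric])
      then have "a = \<phi> ((h [^]\<^bsub>G\<^esub> k) [^]\<^bsub>G\<^esub> s) (\<phi> (h [^]\<^bsub>G\<^esub> r) x)"
        using act_pow_add[OF h, of "k * s" r x] x(1) by (simp add: kk)
      moreover have "\<phi> (h [^]\<^bsub>G\<^esub> r) x \<in> K'"
        using x(2) \<open>k \<noteq> 0\<close> by (auto simp: K'_def r_def)
      moreover have "(h [^]\<^bsub>G\<^esub> k) [^]\<^bsub>G\<^esub> s \<in> generate G {h [^]\<^bsub>G\<^esub> k}"
        using gen[of "h [^]\<^bsub>G\<^esub> k"] h by simp
      ultimately show "a \<in> (\<Union>g\<in>generate G {h [^]\<^bsub>G\<^esub> k}. \<phi> g ` K')"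
        by blast
    qed
  qed
  ultimately have coc: "acts_cocompactly_on \<phi> (generate G {h [^]\<^bsub>G\<^esub> k}) A"
    unfolding acts_cocompactly_on_def by blast
  have k1: "1 \<le> \<bar>real_of_int k\<bar>"
    using \<open>k \<noteq> 0\<close> by linarith
  define L' where "L' = L * \<bar>real_of_int k\<bar>"
  have "L \<le> L'"
    using LB k1 by (simp add: L'_def)
  have "1 \<le> L'"
    using \<open>L \<le> L'\<close> LB by simp
  have "quasi_geodesic (\<lambda>i::int. \<phi> ((h [^]\<^bsub>G\<^esub> k) [^]\<^bsub>G\<^esub> i) p)"
    unfolding quasi_geodesic_def
  proof (rule exI[of _ L'], rule conjI, fact, rule exI[of _ B], intro conjI allI)
    show "0 \<le> B" by (rule LB(2))
    fix i j :: int
    have eq: "\<bar>real_of_int (k * i - k * j)\<bar> = \<bar>real_of_int k\<bar> * \<bar>real_of_int (i - j)\<bar>"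
      by (simp add: abs_mult[symmetric] right_diff_distrib)
    have "\<bar>real_of_int (i - j)\<bar> / L' \<le> \<bar>real_of_int (i - j)\<bar> / L"
      using \<open>L \<le> L'\<close> LB by (intro divide_left_mono) auto
    also have "\<dots> \<le> \<bar>real_of_int (k * i - k * j)\<bar> / L"
      unfolding eq using k1 LB mult_right_mono[OF k1, of "\<bar>real_of_int (i - j)\<bar>"]
      by (intro divide_right_mono) auto
    finally show "\<bar>real_of_int (i - j)\<bar> / L' - B
        \<le> dist (\<phi> ((h [^]\<^bsub>G\<^esub> k) [^]\<^bsub>G\<^esub> i) p) (\<phi> ((h [^]\<^bsub>G\<^esub> k) [^]\<^bsub>G\<^esub> j) p)"
      using q[of "k * i" "k * j"] unfolding kk by linarith
    show "dist (\<phi> ((h [^]\<^bsub>G\<^esub> k) [^]\<^bsub>G\<^esub> i) p) (\<phi> ((h [^]\<^bsub>G\<^esub> k) [^]\<^bsub>G\<^esub> j) p)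
        \<le> L' * \<bar>real_of_int (i - j)\<bar> + B"
      using q[of "k * i" "k * j"] unfolding kk eq L'_def by (simp add: mult.assoc)
  qed
  then show ?thesis
    using coc A(2) h unfolding strongly_contracting_element_def by blast
qed

lemma (in G_space) contracting_axis_exists:
  assumes sc: "strongly_contracting_element G \<phi> p h"
  shows "\<exists>A C R. contracting_axis G \<phi> h A p C R"
proof -
  have h: "h \<in> carrier G"
    using sc by (simp add: strongly_contracting_element_def)
  obtain L B where LB: "L \<ge> 1" "B \<ge> 0" and
      q: "\<And>i j::int. \<bar>real_of_int (i - j)\<bar> / L - B \<le> dist (\<phi> (h [^]\<^bsub>G\<^esub> i) p) (\<phi> (h [^]\<^bsub>G\<^esub> j) p)"
    using sc unfolding strongly_contracting_element_def quasi_geodesic_def by blast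
  obtain A \<pi> where A: "acts_cocompactly_on \<phi> (generate G {h}) A" "strongly_contracting_map A \<pi>"
    using sc unfolding strongly_contracting_element_def by blast
  obtain K where K: "compact K" "(\<Union>g\<in>generate G {h}. \<phi> g ` K) = A"
    using A(1) unfolding acts_cocompactly_on_def by blast
  have gen: "generate G {h} = range (\<lambda>i::int. h [^]\<^bsub>G\<^esub> i)"
    using generate_pow[OF h] by auto
  have A_eq: "A = (\<Union>i::int. \<phi> (h [^]\<^bsub>G\<^esub> i) ` K)"
    using K(2) gen by auto
  have "\<exists>C\<ge>0. bottleneck A C"
    using strongly_contracting_bottleneck[OF geodesic_on_ex A(2)] .
  then obtain C where C: "C \<ge> 0" "bottleneck A C" by blast
  obtain R where R: "\<And>x. x \<in> K \<Longrightarrow> dist x p \<le> R"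
    using compact_imp_bounded[OF K(1)] unfolding bounded_any_center[of K p] by (auto simp: dist_commute)
  have act_h: "\<phi> h (\<phi> (h [^]\<^bsub>G\<^esub> i) x) = \<phi> (h [^]\<^bsub>G\<^esub> (1 + i)) x" for i :: int and x
    using act_pow_add[OF h, of 1 i x] h by simp
  have "contracting_axis G \<phi> h A p C R"
  proof
    show "h \<in> carrier G" "bottleneck A C" "0 \<le> C"
      using h C by auto
    show "A \<noteq> {}"
      using A(2) by (auto simp: strongly_contracting_map_def coarse_map_def)
    show "\<phi> h ` A = A"
    proof
      show "\<phi> h ` A \<subseteq> A"
        unfolding A_eq using act_h by blast
      show "A \<subseteq> \<phi> h ` A"
      proof
        fix a assume "a \<in> A"
        then obtain i :: int and x where x: "x \<in> K" "a = \<phi> (h [^]\<^bsub>G\<^esub> i) x"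
          unfolding A_eq by blast
        then have "a = \<phi> h (\<phi> (h [^]\<^bsub>G\<^esub> (i - 1)) x)"
          by (simp add: act_h)
        then show "a \<in> \<phi> h ` A"
          unfolding A_eq using x(1) by blast
      qed
    qed
    show "\<exists>k::int. dist a (\<phi> (h [^]\<^bsub>G\<^esub> k) p) \<le> R" if a: "a \<in> A" for a
    proof -
      obtain i :: int and x where x: "x \<in> K" "a = \<phi> (h [^]\<^bsub>G\<^esub> i) x"
        using a unfolding A_eq by blast
      then have "dist a (\<phi> (h [^]\<^bsub>G\<^esub> i) p) \<le> R"
        using R h by (simp add: isometric)
      then show ?thesis ..
    qed
    show "\<exists>k0. \<forall>k::int. k0 \<le> \<bar>k\<bar> \<longrightarrow> r < dist (\<phi> (h [^]\<^bsub>G\<^esub> k) p) p" for r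
    proof (intro exI allI impI)
      fix k :: int
      assume "\<lceil>L * (r + B)\<rceil> + 1 \<le> \<bar>k\<bar>"
      then have "L * (r + B) < \<bar>real_of_int k\<bar>"
        by linarith
      then have "r + B < \<bar>real_of_int k\<bar> / L"
        using LB by (simp add: less_divide_eq mult.commute)
      then show "r < dist (\<phi> (h [^]\<^bsub>G\<^esub> k) p) p"
        using q[of k 0] by simp
    qed
  qed
  then show ?thesis by blast
qed

lemma (in contracting_axis) normal_subgroup_strongly_contracting:
  assumes "N \<lhd> G" and "infinite N" and sc: "strongly_contracting_element G \<phi> p h"
  shows "\<exists>n\<in>N. strongly_contracting_element G \<phi> p n"
proof (cases "\<forall>n\<in>N. commensurates n")
  case True
  then obtain k :: int where k: "k \<noteq> 0" "h [^] k \<in> N"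
    using normal_contains_power[OF assms(1,2)] by auto
  show ?thesis
    using k(2) strongly_contracting_element_pow[OF sc k(1)] by (rule bexI[rotated])
next
  case False
  interpret N: normal N G by fact
  obtain n where n: "n \<in> N" "\<not> commensurates n"
    using False by blast
  then have nG: "n \<in> carrier G"
    using N.subset by blast
  obtain m :: int where m: "strongly_contracting_element G \<phi> p (n \<otimes> h [^] m \<otimes> inv n \<otimes> h [^] (-m))"
    using commutator_strongly_contracting[OF nG n(2)] by blast
  \<comment> \<open>The commutator is \<open>n\<close> times a conjugate of \<open>inv n\<close>, so
    normality puts it in \<open>N\<close>.\<close>
  have "h [^] m \<otimes> inv n \<otimes> inv (h [^] m) \<in> N"
    using n(1) by (intro N.inv_op_closed2) auto
  then have "n \<otimes> (h [^] m \<otimes> inv n \<otimes> inv (h [^] m)) \<in> N"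
    by (rule N.m_closed[OF n(1)])
  also have "n \<otimes> (h [^] m \<otimes> inv n \<otimes> inv (h [^] m)) = n \<otimes> h [^] m \<otimes> inv n \<otimes> h [^] (-m)"
    using nG by (simp add: m_assoc int_pow_neg)
  finally show ?thesis
    using m by (rule bexI[rotated])
qed

theorem proposition3p1:
  fixes G :: "('g, 'm) monoid_scheme"
    and \<phi> :: "'g \<Rightarrow> 'x::metric_space \<Rightarrow> 'x"
    and p :: 'x
  assumes "finitely_generated_group G"
    and "G_space G \<phi>"
    and "\<exists>h\<in>carrier G. strongly_contracting_element G \<phi> p h"
  shows "\<forall>N. N \<lhd> G \<and> infinite N \<longrightarrow> (\<exists>n\<in>N. strongly_contracting_element G \<phi> p n)"
proof -
  obtain h where h: "strongly_contracting_element G \<phi> p h"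
    using assms(3) by blast
  obtain A C R where "contracting_axis G \<phi> h A p C R"
    using G_space.contracting_axis_exists[OF assms(2) h] by blast
  then show ?thesis
    using contracting_axis.normal_subgroup_strongly_contracting[OF _ _ _ h] by blast
qed

end
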